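(* Let $\mathbf{w} = (1,1,w_2,\dots,w_{r+1})$ be a weight vector, $p$ a prime, $X$ a hypersurface of weighted degree $d$ in $\mathbb{P}_{\mathbb{Q}}(\mathbf{w})$ defined by an integral weighted homogeneous form, and $P$ an $\mathbb{F}_p$-point of multiplicity $m_P$ on $X_p$. Suppose $\boldsymbol\xi_1,\dots,\boldsymbol\xi_s$ are $s$ distinct primitive $(r+2)$-tuples of integers representing points of $X$, each reducing modulo $p$ to $P$, with $\gcd(\xi_{0,l},\xi_{1,l}) = 1$ for $1 \le l \le s$. Let $M_1,\dots,M_s$ be monomials in $x_0,\dots,x_{r+1}$ of the same weighted degree. Then there exists a positive number $\kappa(d,r)$, depending only on $d$ and $r$, such that the determinant of the $s\times s$ matrix $(M_j(\boldsymbol\xi_l))_{j,l}$ is divisible by $p^N$ for some integer $$N > \left(\frac{r!}{m_P}\right)^{1/r}\frac{r}{r+1}\, s^{1+1/r} - \kappa(d,r)s.$$ If $P$ is non-singular (so $m_P = 1$), then there exists a positive number $\kappa'(r)$, depending only on $r$, such that $N > (r!)^{1/r}\frac{r}{r+1}s^{1+1/r} - \kappa'(r)s$.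
   Context: $\mathbb{P}_{\mathbb{Q}}(\mathbf{w})$ denotes weighted projective space: nonzero vectors modulo $\mathbf{x}\sim(\lambda^{w_0}x_0,\dots,\lambda^{w_{r+1}}x_{r+1})$. The weighted degree of $x_0^{\beta_0}\cdots x_{r+1}^{\beta_{r+1}}$ is $\sum \beta_i w_i$. $X_p$ denotes the reduction of $X$ modulo $p$, and $X$ has dimension $r$. *)

theory Defs
  imports
    Complex_Main
    "HOL-Library.FuncSet"
    "HOL-Library.Poly_Mapping"
    "HOL-Algebra.Algebraic_Closure_Type"
    "HOL-Number_Theory.Residues"
    "Jordan_Normal_Form.Determinant"
begin

type_synonym monomial = "nat \<Rightarrow>\<^sub>0 nat"
type_synonym 'a mpoly = "monomial \<Rightarrow>\<^sub>0 'a"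

definition Var :: "nat \<Rightarrow> int mpoly" where
  "Var i = Poly_Mapping.single (Poly_Mapping.single i 1) 1"

definition eval_monomial :: "(nat \<Rightarrow> 'a::comm_ring_1) \<Rightarrow> monomial \<Rightarrow> 'a" where
  "eval_monomial x \<alpha> = (\<Prod>i\<in>Poly_Mapping.keys \<alpha>. x i ^ Poly_Mapping.lookup \<alpha> i)"

text \<open>The target is an arbitrary commutative ring: besides evaluating at integer and rational
  points, this is used with polynomials for \<open>x i\<close>, where it is substitution.\<close>

definition eval_mpoly :: "(nat \<Rightarrow> 'a::comm_ring_1) \<Rightarrow> int mpoly \<Rightarrow> 'a" where
  "eval_mpoly x F =
    (\<Sum>\<alpha>\<in>Poly_Mapping.keys F. of_int (Poly_Mapping.lookup F \<alpha>) * eval_monomial x \<alpha>)"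

definition partial_deriv :: "nat \<Rightarrow> int mpoly \<Rightarrow> int mpoly" where
  "partial_deriv j F =
    (\<Sum>\<alpha>\<in>Poly_Mapping.keys F.
       Poly_Mapping.single (\<alpha> - Poly_Mapping.single j 1)
         (Poly_Mapping.lookup F \<alpha> * int (Poly_Mapping.lookup \<alpha> j)))"

definition weighted_degree :: "(nat \<Rightarrow> nat) \<Rightarrow> monomial \<Rightarrow> nat" where
  "weighted_degree w \<alpha> = (\<Sum>i\<in>Poly_Mapping.keys \<alpha>. Poly_Mapping.lookup \<alpha> i * w i)"

definition weighted_form :: "nat set \<Rightarrow> (nat \<Rightarrow> nat) \<Rightarrow> nat \<Rightarrow> int mpoly \<Rightarrow> bool" where
  "weighted_form I w d F \<longleftrightarrow>
    F \<noteq> 0 \<and>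
    (\<forall>\<alpha>\<in>Poly_Mapping.keys F. Poly_Mapping.keys \<alpha> \<subseteq> I \<and> weighted_degree w \<alpha> = d)"

text \<open>The set of points over the field \<open>K\<close> of the weighted projective space with coordinates
  \<open>x i\<close>, \<open>i \<in> I\<close>, of weight \<open>w i\<close>.\<close>

definition nonzero_vectors :: "('a, 'b) ring_scheme \<Rightarrow> nat set \<Rightarrow> (nat \<Rightarrow> 'a) set" where
  "nonzero_vectors K I = {x \<in> I \<rightarrow>\<^sub>E carrier K. \<exists>i\<in>I. x i \<noteq> \<zero>\<^bsub>K\<^esub>}"

definition weighted_scaling ::
  "('a, 'b) ring_scheme \<Rightarrow> nat set \<Rightarrow> (nat \<Rightarrow> nat) \<Rightarrow> ((nat \<Rightarrow> 'a) \<times> (nat \<Rightarrow> 'a)) set" where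
  "weighted_scaling K I w =
    {(x, y). x \<in> nonzero_vectors K I \<and> y \<in> nonzero_vectors K I \<and>
       (\<exists>c\<in>carrier K - {\<zero>\<^bsub>K\<^esub>}. \<forall>i\<in>I. y i = (c [^]\<^bsub>K\<^esub> w i) \<otimes>\<^bsub>K\<^esub> x i)}"

definition weighted_proj_space ::
  "('a, 'b) ring_scheme \<Rightarrow> nat set \<Rightarrow> (nat \<Rightarrow> nat) \<Rightarrow> (nat \<Rightarrow> 'a) set set" where
  "weighted_proj_space K I w = nonzero_vectors K I // weighted_scaling K I w"

definition rat_ring :: "rat ring" where
  "rat_ring = ring_of_type_algebra"

definition hypersurface :: "nat set \<Rightarrow> (nat \<Rightarrow> nat) \<Rightarrow> int mpoly \<Rightarrow> (nat \<Rightarrow> rat) set set" where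
  "hypersurface I w F = {Q \<in> weighted_proj_space rat_ring I w. \<forall>x\<in>Q. eval_mpoly x F = 0}"

definition represents :: "nat set \<Rightarrow> (nat \<Rightarrow> int) \<Rightarrow> (nat \<Rightarrow> rat) set \<Rightarrow> bool" where
  "represents I \<xi> Q \<longleftrightarrow> (\<lambda>i\<in>I. rat_of_int (\<xi> i)) \<in> Q"

definition primitive_tuple :: "nat set \<Rightarrow> (nat \<Rightarrow> int) \<Rightarrow> bool" where
  "primitive_tuple I \<xi> \<longleftrightarrow> Gcd (\<xi> ` I) = 1"

text \<open>The elements of the residue field \<open>residue_ring (int p)\<close> are the integers
  \<open>0, \<dots>, p - 1\<close>.\<close>

definition reduces_to :: "nat set \<Rightarrow> nat \<Rightarrow> (nat \<Rightarrow> int) \<Rightarrow> (nat \<Rightarrow> int) set \<Rightarrow> bool" where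
  "reduces_to I p \<xi> P \<longleftrightarrow> (\<lambda>i\<in>I. \<xi> i mod int p) \<in> P"

text \<open>The form \<open>F\<close> determines the hypersurface \<open>X\<close> over the rationals, and \<open>X\<close> determines \<open>F\<close> only
  up to a constant factor.  The reduction of \<open>X\<close> modulo \<open>p\<close> is cut out by the primitive integral
  form defining \<open>X\<close>; if \<open>p\<close> does not divide \<open>F\<close>, this is the same as \<open>F\<close> modulo \<open>p\<close> up to a unit.\<close>

definition primitive_form :: "int mpoly \<Rightarrow> int mpoly" where
  "primitive_form F =
    Poly_Mapping.map
      (\<lambda>c. c div Gcd (Poly_Mapping.lookup F ` Poly_Mapping.keys F)) F"

definition reduced_hypersurface ::
  "nat set \<Rightarrow> (nat \<Rightarrow> nat) \<Rightarrow> nat \<Rightarrow> int mpoly \<Rightarrow> (nat \<Rightarrow> int) set set" where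
  "reduced_hypersurface I w p F =
    {P \<in> weighted_proj_space (residue_ring (int p)) I w.
       \<forall>a\<in>P. int p dvd eval_mpoly a (primitive_form F)}"

text \<open>If \<open>w i = 1\<close>, the points with \<open>x i \<noteq> 0\<close> form an affine space with coordinates
  \<open>x j / x i ^ w j\<close>, \<open>j \<noteq> i\<close>, and the hypersurface is given there by the dehomogenised form.
  The affine coordinates of a point are those of its representative with \<open>x i = 1\<close>.\<close>

definition dehomogenise :: "nat \<Rightarrow> int mpoly \<Rightarrow> int mpoly" where
  "dehomogenise i F = eval_mpoly (\<lambda>j. if j = i then 1 else Var j) F"

definition affine_chart ::
  "nat set \<Rightarrow> (nat \<Rightarrow> nat) \<Rightarrow> (nat \<Rightarrow> int) set \<Rightarrow> nat \<Rightarrow> (nat \<Rightarrow> int) \<Rightarrow> bool" where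
  "affine_chart I w P i a \<longleftrightarrow> i \<in> I \<and> w i = 1 \<and> a \<in> P \<and> a i = 1"

text \<open>The order of vanishing modulo \<open>p\<close> of a polynomial at \<open>a\<close>: the degree of the lowest
  homogeneous part, modulo \<open>p\<close>, of its expansion around \<open>a\<close>.\<close>

definition translate :: "(nat \<Rightarrow> int) \<Rightarrow> int mpoly \<Rightarrow> int mpoly" where
  "translate a G = eval_mpoly (\<lambda>j. of_int (a j) + Var j) G"

definition vanishing_order :: "nat \<Rightarrow> (nat \<Rightarrow> int) \<Rightarrow> int mpoly \<Rightarrow> nat" where
  "vanishing_order p a G =
    (LEAST k. \<exists>\<beta>. weighted_degree (\<lambda>_. 1) \<beta> = k \<and>
                  \<not> int p dvd Poly_Mapping.lookup (translate a G) \<beta>)"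

text \<open>Multiplicity and non-singularity of a point of the reduction.  They are local notions and do
  not depend on the chart; they are only meant for points lying in some chart with \<open>w i = 1\<close>, where
  the ambient space is smooth.  A point reducing from a tuple whose coordinates of weight 1 are
  coprime always does.\<close>

definition has_multiplicity ::
  "nat set \<Rightarrow> (nat \<Rightarrow> nat) \<Rightarrow> nat \<Rightarrow> int mpoly \<Rightarrow> (nat \<Rightarrow> int) set \<Rightarrow> nat \<Rightarrow> bool" where
  "has_multiplicity I w p F P m \<longleftrightarrow>
    P \<in> reduced_hypersurface I w p F \<and>
    (\<exists>i a. affine_chart I w P i a \<and>
       m = vanishing_order p a (dehomogenise i (primitive_form F)))"

definition nonsingular_point ::
  "nat set \<Rightarrow> (nat \<Rightarrow> nat) \<Rightarrow> nat \<Rightarrow> int mpoly \<Rightarrow> (nat \<Rightarrow> int) set \<Rightarrow> bool" where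
  "nonsingular_point I w p F P \<longleftrightarrow>
    P \<in> reduced_hypersurface I w p F \<and>
    (\<exists>i a. affine_chart I w P i a \<and>
       (\<exists>j\<in>I - {i}. \<not> int p dvd
          eval_mpoly a (partial_deriv j (dehomogenise i (primitive_form F)))))"

end

theory Submission
  imports Defs
begin

text \<open>In the chart \<open>x i = 1\<close> every point is congruent to \<open>a\<close> modulo \<open>p\<close>, so its coordinates
  relative to \<open>a\<close> are divisible by \<open>p\<close> and a monomial of degree \<open>k\<close> in them is divisible by \<open>p ^ k\<close>.
  Modulo a power of \<open>p\<close>, division by the equation of \<open>X\<close> rewrites each \<open>M j\<close> as a combination of the
  monomials not divisible by a fixed monomial \<open>\<gamma>\<close> of degree at most \<open>m\<close>, and multilinearity of the
  determinant gives divisibility by \<open>p ^ N\<close> with \<open>N\<close> the least sum of degrees of \<open>s\<close> distinct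
  such monomials.  At most \<open>m * ((k + r) choose r)\<close> of them have degree at most \<open>k\<close>, so the \<open>t\<close>-th
  smallest degree is at least \<open>(r! t / m) ^ (1/r) - r\<close>; summing over \<open>t\<close> allows \<open>r + 1\<close> for
  both constants.\<close>

subsection \<open>Evaluation of polynomials\<close>

abbreviation total_degree :: "monomial \<Rightarrow> nat" where
  "total_degree \<equiv> weighted_degree (\<lambda>_. 1)"

lemma eval_monomial_superset:
  assumes "finite A" "Poly_Mapping.keys \<alpha> \<subseteq> A"
  shows "eval_monomial x \<alpha> = (\<Prod>i\<in>A. x i ^ Poly_Mapping.lookup \<alpha> i)"
  unfolding eval_monomial_def
  by (rule prod.mono_neutral_left[OF assms]) (auto simp: in_keys_iff)

lemma eval_monomial_0 [simp]: "eval_monomial x 0 = 1"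
  by (simp add: eval_monomial_def)

lemma eval_monomial_single [simp]: "eval_monomial x (Poly_Mapping.single i n) = x i ^ n"
  by (subst eval_monomial_superset[of "{i}"]) auto

lemma eval_monomial_add: "eval_monomial x (\<alpha> + \<beta>) = eval_monomial x \<alpha> * eval_monomial x \<beta>"
proof -
  let ?A = "Poly_Mapping.keys \<alpha> \<union> Poly_Mapping.keys \<beta>"
  have "Poly_Mapping.keys (\<alpha> + \<beta>) \<subseteq> ?A" by (rule Poly_Mapping.keys_add)
  then show ?thesis
    by (simp add: eval_monomial_superset[of ?A] lookup_add power_add prod.distrib)
qed

lemma eval_monomial_cong:
  assumes "\<And>i. i \<in> Poly_Mapping.keys \<alpha> \<Longrightarrow> x i = y i"
  shows "eval_monomial x \<alpha> = eval_monomial y \<alpha>"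
  using assms by (simp add: eval_monomial_def)

lemma weighted_degree_superset:
  assumes "finite A" "Poly_Mapping.keys \<alpha> \<subseteq> A"
  shows "weighted_degree w \<alpha> = (\<Sum>i\<in>A. Poly_Mapping.lookup \<alpha> i * w i)"
  unfolding weighted_degree_def
  by (rule sum.mono_neutral_left[OF assms]) (auto simp: in_keys_iff)

lemma weighted_degree_add: "weighted_degree w (\<alpha> + \<beta>) = weighted_degree w \<alpha> + weighted_degree w \<beta>"
proof -
  let ?A = "Poly_Mapping.keys \<alpha> \<union> Poly_Mapping.keys \<beta>"
  have "Poly_Mapping.keys (\<alpha> + \<beta>) \<subseteq> ?A" by (rule Poly_Mapping.keys_add)
  then show ?thesis
    by (simp add: weighted_degree_superset[of ?A] lookup_add sum.distrib add_mult_distrib)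
qed

lemma weighted_degree_single [simp]: "weighted_degree w (Poly_Mapping.single i n) = n * w i"
  by (subst weighted_degree_superset[of "{i}"]) auto

lemma eval_mpoly_superset:
  assumes "finite A" "Poly_Mapping.keys F \<subseteq> A"
  shows "eval_mpoly x F = (\<Sum>\<alpha>\<in>A. of_int (Poly_Mapping.lookup F \<alpha>) * eval_monomial x \<alpha>)"
  unfolding eval_mpoly_def
  by (rule sum.mono_neutral_left[OF assms]) (auto simp: in_keys_iff)

lemma eval_mpoly_0 [simp]: "eval_mpoly x 0 = 0"
  by (simp add: eval_mpoly_def)

lemma eval_mpoly_single [simp]:
  "eval_mpoly x (Poly_Mapping.single \<alpha> c) = of_int c * eval_monomial x \<alpha>"
  by (subst eval_mpoly_superset[of "{\<alpha>}"]) auto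

lemma eval_mpoly_Var [simp]: "eval_mpoly x (Var i) = x i"
  by (simp add: Var_def)

lemma eval_mpoly_of_int [simp]: "eval_mpoly x (of_int c) = of_int c"
  by (simp del: single_of_int flip: single_of_int)

lemma eval_mpoly_1 [simp]: "eval_mpoly x 1 = 1"
  using eval_mpoly_of_int[of x 1] by simp

lemma eval_mpoly_add: "eval_mpoly x (F + G) = eval_mpoly x F + eval_mpoly x G"
proof -
  let ?A = "Poly_Mapping.keys F \<union> Poly_Mapping.keys G"
  have "Poly_Mapping.keys (F + G) \<subseteq> ?A" by (rule Poly_Mapping.keys_add)
  then show ?thesis
    by (simp add: eval_mpoly_superset[of ?A] lookup_add sum.distrib distrib_right)
qed

lemma eval_mpoly_sum: "eval_mpoly x (sum f A) = (\<Sum>a\<in>A. eval_mpoly x (f a))"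
  by (induction A rule: infinite_finite_induct) (simp_all add: eval_mpoly_add)

lemma mpoly_eq_sum_single:
  fixes F :: "'a::type \<Rightarrow>\<^sub>0 'b::comm_monoid_add"
  shows "F = (\<Sum>\<alpha>\<in>Poly_Mapping.keys F. Poly_Mapping.single \<alpha> (Poly_Mapping.lookup F \<alpha>))"
  by (rule poly_mapping_eqI)
    (auto simp: lookup_sum lookup_single when_def in_keys_iff)

lemma eval_mpoly_mult: "eval_mpoly x (F * G) = eval_mpoly x F * eval_mpoly x G"
proof -
  have "eval_mpoly x (F * G) = eval_mpoly x
     ((\<Sum>\<alpha>\<in>Poly_Mapping.keys F. Poly_Mapping.single \<alpha> (Poly_Mapping.lookup F \<alpha>)) *
      (\<Sum>\<alpha>\<in>Poly_Mapping.keys G. Poly_Mapping.single \<alpha> (Poly_Mapping.lookup G \<alpha>)))"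
    by (simp flip: mpoly_eq_sum_single)
  also have "\<dots> = eval_mpoly x F * eval_mpoly x G"
    unfolding eval_mpoly_def[of x F] eval_mpoly_def[of x G]
    by (simp add: sum_product eval_mpoly_sum mult_single eval_monomial_add mult_ac)
  finally show ?thesis .
qed

lemma eval_mpoly_power: "eval_mpoly x (F ^ n) = eval_mpoly x F ^ n"
  by (induction n) (simp_all add: eval_mpoly_mult)

lemma eval_mpoly_prod: "eval_mpoly x (prod f A) = (\<Prod>a\<in>A. eval_mpoly x (f a))"
  by (induction A rule: infinite_finite_induct) (simp_all add: eval_mpoly_mult)

text \<open>Evaluation at polynomials is substitution, so this is associativity of substitution; it
  yields the values of \<open>translate\<close> and \<open>dehomogenise\<close> without expanding
  them.\<close>

lemma eval_mpoly_eval_mpoly: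
  "eval_mpoly x (eval_mpoly y F) = eval_mpoly (\<lambda>i. eval_mpoly x (y i)) F"
  unfolding eval_mpoly_def[of y] eval_mpoly_def[of "\<lambda>i. eval_mpoly x (y i)"]
  by (simp add: eval_mpoly_sum eval_mpoly_mult eval_monomial_def eval_mpoly_prod eval_mpoly_power)

lemma eval_mpoly_cong:
  assumes "\<And>\<alpha> i. \<alpha> \<in> Poly_Mapping.keys F \<Longrightarrow> i \<in> Poly_Mapping.keys \<alpha> \<Longrightarrow> x i = y i"
  shows "eval_mpoly x F = eval_mpoly y F"
  unfolding eval_mpoly_def using assms
  by (intro sum.cong refl arg_cong2[where f = "(*)"] eval_monomial_cong) auto

lemma eval_monomial_Var: "eval_monomial Var \<alpha> = Poly_Mapping.single \<alpha> 1"
proof -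
  have power: "Var i ^ n = Poly_Mapping.single (Poly_Mapping.single i n) 1" for i n
    by (induction n) (simp_all add: Var_def mult_single flip: single_add)
  have "(\<Prod>i\<in>A. Poly_Mapping.single (Poly_Mapping.single i (g i)) (1::int)) =
      Poly_Mapping.single (\<Sum>i\<in>A. Poly_Mapping.single i (g i)) 1" if "finite A" for A and g :: "nat \<Rightarrow> nat"
    using that by induction (simp_all add: mult_single)
  then show ?thesis
    unfolding eval_monomial_def power by (simp flip: mpoly_eq_sum_single)
qed

lemma eval_mpoly_Var_id: "eval_mpoly Var F = F"
proof -
  have *: "of_int c * Poly_Mapping.single \<alpha> 1 = Poly_Mapping.single \<alpha> c" for c :: int and \<alpha> :: monomial
    by (simp add: mult_single flip: single_of_int)
  show ?thesis
    unfolding eval_mpoly_def eval_monomial_Var * by (rule mpoly_eq_sum_single[symmetric])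
qed

section \<open>Translation and dehomogenisation as substitutions\<close>

lemma translate_inverse: "translate (\<lambda>i. - a i) (translate a G) = G"
  by (simp add: translate_def eval_mpoly_eval_mpoly eval_mpoly_add eval_mpoly_Var_id)

lemma eval_mpoly_translate: "eval_mpoly x (translate a G) = eval_mpoly (\<lambda>i. of_int (a i) + x i) G"
  by (simp add: translate_def eval_mpoly_eval_mpoly eval_mpoly_add)

lemma eval_mpoly_dehomogenise: "eval_mpoly x (dehomogenise i F) = eval_mpoly (x(i := 1)) F"
  unfolding dehomogenise_def eval_mpoly_eval_mpoly
  by (rule arg_cong[where f = "\<lambda>y. eval_mpoly y F"]) auto

text \<open>Links local coordinates \<open>x\<close> around \<open>a\<close> to the form itself:
  \<open>x i = 0\<close> keeps the \<open>i\<close>-th coordinate \<open>a i + x i\<close> equal to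
  1, as dehomogenisation demands.\<close>

lemma eval_mpoly_translate_dehomogenise:
  assumes "a i = 1" "x i = 0"
  shows "eval_mpoly x (translate a (dehomogenise i F)) = eval_mpoly (\<lambda>j. of_int (a j) + x j) F"
  unfolding eval_mpoly_translate eval_mpoly_dehomogenise
  by (rule arg_cong[where f = "\<lambda>y. eval_mpoly y F"]) (use assms in auto)

section \<open>Polynomials in a given set of variables\<close>

text \<open>Variables are indexed by all naturals, so the restriction to the coordinates at hand has
  to be carried along; the counting of monomials depends on it.\<close>

definition mpolys_in :: "nat set \<Rightarrow> int mpoly set" where
  "mpolys_in J = {F. \<forall>\<alpha>\<in>Poly_Mapping.keys F. Poly_Mapping.keys \<alpha> \<subseteq> J}"

lemma mpolys_in_of_int: "of_int c \<in> mpolys_in J"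
proof -
  have "Poly_Mapping.keys (of_int c :: int mpoly) \<subseteq> {0}"
    by (simp del: single_of_int flip: single_of_int)
  then show ?thesis by (auto simp: mpolys_in_def)
qed

lemma mpolys_in_0: "0 \<in> mpolys_in J"
  by (simp add: mpolys_in_def)

lemma mpolys_in_1: "1 \<in> mpolys_in J"
  using mpolys_in_of_int[of 1 J] by simp

lemma mpolys_in_Var: "i \<in> J \<Longrightarrow> Var i \<in> mpolys_in J"
  by (auto simp: mpolys_in_def Var_def)

lemma mpolys_in_add: "F \<in> mpolys_in J \<Longrightarrow> G \<in> mpolys_in J \<Longrightarrow> F + G \<in> mpolys_in J"
  using Poly_Mapping.keys_add[of F G] by (auto simp: mpolys_in_def)

lemma mpolys_in_mult:
  assumes "F \<in> mpolys_in J" "G \<in> mpolys_in J"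
  shows "F * G \<in> mpolys_in J"
  unfolding mpolys_in_def
proof (intro CollectI ballI)
  fix \<alpha> assume "\<alpha> \<in> Poly_Mapping.keys (F * G)"
  then obtain \<beta> \<gamma> where "\<alpha> = \<beta> + \<gamma>" "\<beta> \<in> Poly_Mapping.keys F" "\<gamma> \<in> Poly_Mapping.keys G"
    using keys_mult[of F G] by blast
  then show "Poly_Mapping.keys \<alpha> \<subseteq> J"
    using assms Poly_Mapping.keys_add[of \<beta> \<gamma>] unfolding mpolys_in_def by blast
qed

lemma mpolys_in_sum: "(\<And>a. a \<in> A \<Longrightarrow> f a \<in> mpolys_in J) \<Longrightarrow> sum f A \<in> mpolys_in J"
  by (induction A rule: infinite_finite_induct)
    (auto intro: mpolys_in_add mpolys_in_0)

lemma mpolys_in_power: "F \<in> mpolys_in J \<Longrightarrow> F ^ n \<in> mpolys_in J"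
  by (induction n) (auto intro: mpolys_in_mult mpolys_in_1)

lemma mpolys_in_prod: "(\<And>a. a \<in> A \<Longrightarrow> f a \<in> mpolys_in J) \<Longrightarrow> prod f A \<in> mpolys_in J"
  by (induction A rule: infinite_finite_induct) (auto intro: mpolys_in_mult mpolys_in_1)

lemma eval_mpoly_in_mpolys_in:
  assumes "F \<in> mpolys_in I" "\<And>i. i \<in> I \<Longrightarrow> x i \<in> mpolys_in J"
  shows "eval_mpoly x F \<in> mpolys_in J"
  unfolding eval_mpoly_def eval_monomial_def using assms
  by (intro mpolys_in_sum mpolys_in_mult mpolys_in_of_int mpolys_in_prod mpolys_in_power)
    (auto simp: mpolys_in_def[of I])

lemma dehomogenise_in_mpolys_in: "F \<in> mpolys_in I \<Longrightarrow> dehomogenise i F \<in> mpolys_in (I - {i})"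
  unfolding dehomogenise_def
  by (erule eval_mpoly_in_mpolys_in) (auto intro: mpolys_in_1 mpolys_in_Var)

lemma translate_in_mpolys_in: "F \<in> mpolys_in J \<Longrightarrow> translate a F \<in> mpolys_in J"
  unfolding translate_def
  by (erule eval_mpoly_in_mpolys_in) (auto intro!: mpolys_in_add mpolys_in_of_int mpolys_in_Var)

section \<open>Coefficients under translation\<close>

lemma lookup_of_int_mult: "Poly_Mapping.lookup (of_int c * F) \<alpha> = c * Poly_Mapping.lookup F \<alpha>"
  for F :: "int mpoly"
proof -
  have "of_int c * F = Poly_Mapping.map ((*) c) F"
    by (simp add: mult_map_scale_conv_mult flip: single_of_int)
  then show ?thesis
    by (simp add: Poly_Mapping.map.rep_eq when_def)
qed

text \<open>Translation has integer coefficients, so a common divisor of the coefficients survives;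
  translation by \<open>- a\<close> undoes it and gives the converse.\<close>

lemma dvd_lookup_translate_iff:
  "(\<forall>\<beta>. c dvd Poly_Mapping.lookup (translate a G) \<beta>) \<longleftrightarrow> (\<forall>\<beta>. c dvd Poly_Mapping.lookup G \<beta>)"
proof -
  have dvd: "c dvd Poly_Mapping.lookup (translate b H) \<beta>" if "\<forall>\<alpha>. c dvd Poly_Mapping.lookup H \<alpha>" for b H \<beta>
  proof -
    have eq: "translate b H = (\<Sum>\<alpha>\<in>Poly_Mapping.keys H. of_int (Poly_Mapping.lookup H \<alpha>) *
        eval_monomial (\<lambda>j. of_int (b j) + Var j) \<alpha>)"
      by (simp add: translate_def eval_mpoly_def)
    show ?thesis
      unfolding eq lookup_sum lookup_of_int_mult using that by (intro dvd_sum dvd_mult2) auto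
  qed
  show ?thesis
    using dvd[of G a] dvd[of "translate a G" "\<lambda>i. - a i"] by (auto simp: translate_inverse)
qed

lemma monomial_split:
  "\<alpha> = Poly_Mapping.single i (Poly_Mapping.lookup \<alpha> i) + (\<alpha> - Poly_Mapping.single i (Poly_Mapping.lookup \<alpha> i))"
  for \<alpha> :: monomial
  by (rule poly_mapping_eqI) (simp add: lookup_add lookup_minus lookup_single when_def)

subsection \<open>Counting monomials\<close>

definition monomials_upto :: "nat set \<Rightarrow> nat \<Rightarrow> monomial set" where
  "monomials_upto J k = {\<alpha>. Poly_Mapping.keys \<alpha> \<subseteq> J \<and> total_degree \<alpha> \<le> k}"

lemma monomials_upto_split:
  assumes "\<alpha> \<in> monomials_upto J k"
  obtains \<beta> where "\<alpha> = Poly_Mapping.single i (Poly_Mapping.lookup \<alpha> i) + \<beta>"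
    "Poly_Mapping.lookup \<alpha> i \<le> k" "\<beta> \<in> monomials_upto (J - {i}) (k - Poly_Mapping.lookup \<alpha> i)"
proof -
  let ?s = "Poly_Mapping.single i (Poly_Mapping.lookup \<alpha> i)"
  define \<beta> where "\<beta> = \<alpha> - ?s"
  have eq: "\<alpha> = ?s + \<beta>"
    unfolding \<beta>_def by (rule monomial_split)
  have keys: "Poly_Mapping.keys \<beta> \<subseteq> J - {i}"
    using assms by (auto simp: \<beta>_def monomials_upto_def in_keys_iff lookup_minus lookup_single when_def
        split: if_splits)
  have "total_degree \<alpha> = Poly_Mapping.lookup \<alpha> i + total_degree \<beta>"
    using arg_cong[OF eq, of total_degree] by (simp add: weighted_degree_add)
  with assms keys show ?thesis
    by (intro that[OF eq]) (auto simp: monomials_upto_def)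
qed

text \<open>Splitting off the exponent \<open>c\<close> of a new variable leaves a monomial of
  degree at most \<open>k - c\<close>; the resulting binomial coefficients add up by the
  hockey-stick identity.\<close>

lemma card_monomials_upto:
  assumes "finite K"
  shows "finite (monomials_upto K k) \<and> card (monomials_upto K k) \<le> (k + card K) choose card K"
  using assms
proof (induction K arbitrary: k)
  case empty
  have "monomials_upto {} k = {0}" by (auto simp: monomials_upto_def weighted_degree_def)
  then show ?case by simp
next
  case (insert i K)
  let ?D = "SIGMA c:{..k}. monomials_upto K (k - c)"
  let ?g = "\<lambda>(c, \<beta>). Poly_Mapping.single i c + \<beta>"
  have sub: "monomials_upto (insert i K) k \<subseteq> ?g ` ?D"
  proof
    fix \<alpha> assume "\<alpha> \<in> monomials_upto (insert i K) k"
    then obtain \<beta> where "\<alpha> = Poly_Mapping.single i (Poly_Mapping.lookup \<alpha> i) + \<beta>"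
        "Poly_Mapping.lookup \<alpha> i \<le> k" "\<beta> \<in> monomials_upto (insert i K - {i}) (k - Poly_Mapping.lookup \<alpha> i)"
      by (rule monomials_upto_split)
    with insert.hyps show "\<alpha> \<in> ?g ` ?D"
      by (intro image_eqI[where x = "(Poly_Mapping.lookup \<alpha> i, \<beta>)"]) auto
  qed
  have fin: "finite ?D" using insert.IH by auto
  have "card (monomials_upto (insert i K) k) \<le> card ?D"
    using card_mono[OF finite_imageI[OF fin] sub] card_image_le[OF fin, of ?g] by linarith
  also have "\<dots> = (\<Sum>c\<le>k. card (monomials_upto K (k - c)))"
    using insert.IH by (simp add: card_SigmaI)
  also have "\<dots> \<le> (\<Sum>c\<le>k. (k - c + card K) choose card K)"
    by (rule sum_mono, rule conjunct2, rule insert.IH)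
  also have "\<dots> = (\<Sum>c\<le>k. (c + card K) choose card K)"
    by (rule sum.reindex_bij_witness[of _ "\<lambda>c. k - c" "\<lambda>c. k - c"]) auto
  also have "\<dots> = Suc (k + card K) choose Suc (card K)"
    by (induction k) auto
  finally show ?case
    using insert.hyps finite_subset[OF sub finite_imageI[OF fin]] by simp
qed

text \<open>A monomial not divisible by \<open>\<gamma>\<close> has at some \<open>i\<close> an
  exponent \<open>c\<close> below that of \<open>\<gamma>\<close>. There are
  \<open>total_degree \<gamma>\<close> such pairs \<open>(i, c)\<close>, and each leaves a monomial
  in \<open>r\<close> variables.\<close>

lemma card_standard_monomials:
  assumes "finite J" "card J = r + 1" "Poly_Mapping.keys \<gamma> \<subseteq> J"
  shows "card {\<alpha> \<in> monomials_upto J k. \<exists>i. Poly_Mapping.lookup \<alpha> i < Poly_Mapping.lookup \<gamma> i}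
    \<le> total_degree \<gamma> * ((k + r) choose r)" (is "card ?S \<le> _")
proof -
  let ?I = "SIGMA i:J. {..<Poly_Mapping.lookup \<gamma> i}"
  \<comment> \<open>The other variables keep the bound \<open>k\<close> instead of
    \<open>k - c\<close>, so that every pair contributes the same binomial coefficient.\<close>
  let ?T = "\<lambda>(i, c). (+) (Poly_Mapping.single i c) ` monomials_upto (J - {i}) k"
  have sub: "?S \<subseteq> \<Union> (?T ` ?I)"
  proof
    fix \<alpha> assume "\<alpha> \<in> ?S"
    then obtain i where i: "\<alpha> \<in> monomials_upto J k" "Poly_Mapping.lookup \<alpha> i < Poly_Mapping.lookup \<gamma> i" by auto
    obtain \<beta> where "\<alpha> = Poly_Mapping.single i (Poly_Mapping.lookup \<alpha> i) + \<beta>"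
        "\<beta> \<in> monomials_upto (J - {i}) (k - Poly_Mapping.lookup \<alpha> i)"
      using i(1) by (rule monomials_upto_split)
    moreover have "i \<in> J" using i(2) assms(3) by (auto simp: in_keys_iff)
    ultimately show "\<alpha> \<in> \<Union> (?T ` ?I)"
      using i(2) by (intro UN_I[where a = "(i, Poly_Mapping.lookup \<alpha> i)"])
        (auto simp: monomials_upto_def intro!: image_eqI[where x = \<beta>])
  qed
  have fin: "finite ?I" using assms(1) by auto
  have T: "finite (?T x) \<and> card (?T x) \<le> (k + r) choose r" if "x \<in> ?I" for x
  proof -
    obtain i c where x: "x = (i, c)" by (cases x)
    have "card (J - {i}) = r" using that assms(1,2) by (auto simp: x)
    with card_monomials_upto[of "J - {i}" k] assms(1) show ?thesis
      by (auto simp: x intro: order_trans[OF card_image_le])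
  qed
  have "card ?S \<le> card (\<Union> (?T ` ?I))"
    using T fin by (intro card_mono[OF _ sub]) blast
  also have "\<dots> \<le> (\<Sum>x\<in>?I. card (?T x))"
    by (rule card_UN_le[OF fin])
  also have "\<dots> \<le> (\<Sum>x\<in>?I. (k + r) choose r)"
    using T by (intro sum_mono) blast
  also have "\<dots> = total_degree \<gamma> * ((k + r) choose r)"
    using assms(1,3) by (simp add: weighted_degree_superset[of J])
  finally show ?thesis .
qed

section \<open>Lower bounds for sums of degrees\<close>

text \<open>Inverts the count: \<open>fact r\<close> times the binomial coefficient is at most
  \<open>(k + r) ^ r\<close>, and the \<open>r\<close>-th root of this is linear in
  \<open>k\<close>.\<close>

lemma total_degree_ge_powr:
  assumes "s \<le> m * ((k + r) choose r)" "m > 0" "r > 0"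
  shows "(fact r / real m * real s) powr (1 / real r) \<le> real k + real r"
proof -
  have "fact r * real s \<le> fact r * (real m * real ((k + r) choose r))"
    using assms(1) by (intro mult_left_mono) (simp_all flip: of_nat_mult)
  also have "\<dots> = real m * real (((k + r) choose r) * fact r)" by simp
  also have "\<dots> \<le> real m * real ((k + r) ^ r)"
    by (intro mult_left_mono of_nat_mono binomial_fact_pow) simp
  finally have "fact r / real m * real s \<le> (real k + real r) ^ r"
    using assms(2) by (simp add: field_simps)
  then have "(fact r / real m * real s) powr (1 / real r) \<le> ((real k + real r) ^ r) powr (1 / real r)"
    by (intro powr_mono2) auto
  also have "\<dots> = real k + real r"
    using assms(3) by (simp add: powr_powr flip: powr_realpow)
  finally show ?thesis .
qed

text \<open>Induction removing an element of maximal degree \<open>k\<close>: all of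
  \<open>A\<close> has degree at most \<open>k\<close>, so the count bounds \<open>card A\<close>
  and hence \<open>k\<close> from below by the last summand.\<close>

lemma sum_total_degree_ge:
  assumes "finite J" "card J = r + 1" "Poly_Mapping.keys \<gamma> \<subseteq> J" "r > 0"
    and m: "total_degree \<gamma> \<le> m" "m > 0"
    and A: "finite A" "\<And>\<alpha>. \<alpha> \<in> A \<Longrightarrow>
      Poly_Mapping.keys \<alpha> \<subseteq> J \<and> (\<exists>i. Poly_Mapping.lookup \<alpha> i < Poly_Mapping.lookup \<gamma> i)"
  shows "(\<Sum>t=1..card A. (fact r / real m * real t) powr (1 / real r) - real r) \<le> real (\<Sum>\<alpha>\<in>A. total_degree \<alpha>)"
  using A
proof (induction "card A" arbitrary: A)
  case 0
  then show ?case by simp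
next
  case (Suc n)
  define k where "k = Max (total_degree ` A)"
  have "A \<noteq> {}" using Suc.hyps by auto
  then have "k \<in> total_degree ` A"
    unfolding k_def using Suc.prems(1) by (intro Max_in) auto
  then obtain \<alpha> where \<alpha>: "\<alpha> \<in> A" "total_degree \<alpha> = k" by auto
  have le: "total_degree \<beta> \<le> k" if "\<beta> \<in> A" for \<beta>
    unfolding k_def using Suc.prems(1) that by (intro Max_ge) auto
  let ?S = "{\<alpha> \<in> monomials_upto J k. \<exists>i. Poly_Mapping.lookup \<alpha> i < Poly_Mapping.lookup \<gamma> i}"
  have "A \<subseteq> ?S" using Suc.prems(2) le by (auto simp: monomials_upto_def)
  then have "card A \<le> card ?S"
    using card_monomials_upto[OF assms(1)] by (intro card_mono) auto
  also have "\<dots> \<le> total_degree \<gamma> * ((k + r) choose r)"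
    using assms by (intro card_standard_monomials) auto
  also have "\<dots> \<le> m * ((k + r) choose r)" using m(1) by simp
  finally have top: "(fact r / real m * real (card A)) powr (1 / real r) - real r \<le> real k"
    using total_degree_ge_powr[of "card A" m k r] m(2) assms(4) by simp
  have n: "n = card (A - {\<alpha>})" using \<alpha>(1) Suc.hyps(2) Suc.prems(1) by simp
  have IH: "(\<Sum>t=1..n. (fact r / real m * real t) powr (1 / real r) - real r)
      \<le> real (\<Sum>\<beta>\<in>A - {\<alpha>}. total_degree \<beta>)"
    using Suc.hyps(1)[OF n] Suc.prems unfolding n by auto
  have "(\<Sum>\<beta>\<in>A. total_degree \<beta>) = k + (\<Sum>\<beta>\<in>A - {\<alpha>}. total_degree \<beta>)"
    using sum.remove[OF Suc.prems(1) \<alpha>(1), of total_degree] \<alpha>(2) by simp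
  with IH top show ?case by (simp flip: Suc.hyps(2))
qed

text \<open>Compares the sum with the integral of \<open>x powr q\<close> from 0 to
  \<open>s\<close>, one unit interval at a time, by the mean value theorem.\<close>

lemma sum_powr_ge:
  assumes "q > 0"
  shows "real s powr (1 + q) / (1 + q) \<le> (\<Sum>t=1..s. real t powr q)"
proof (induction s)
  case 0
  then show ?case by simp
next
  case (Suc s)
  have "real (Suc s) powr (1 + q) - real s powr (1 + q) \<le> (1 + q) * real (Suc s) powr q"
  \<comment> \<open>The derivative of the power is only available at positive points, so the
    interval from 0 to 1 is treated apart.\<close>
  proof (cases "s = 0")
    case True
    then show ?thesis using assms by simp
  next
    case False
    have "\<exists>z. real s < z \<and> z < real (Suc s) \<and>
      real (Suc s) powr (1 + q) - real s powr (1 + q) = (real (Suc s) - real s) * ((1 + q) * z powr (1 + q - 1))"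
      using False by (intro MVT2 has_real_derivative_powr) auto
    then obtain z where z: "real s < z" "z < real (Suc s)"
      "real (Suc s) powr (1 + q) - real s powr (1 + q) = (1 + q) * z powr q" by auto
    have "z powr q \<le> real (Suc s) powr q"
      using z assms by (intro powr_mono2) auto
    then show ?thesis unfolding z(3) using assms by (intro mult_left_mono) auto
  qed
  then have "(real (Suc s) powr (1 + q) - real s powr (1 + q)) / (1 + q) \<le> real (Suc s) powr q"
    using assms by (simp add: field_simps)
  with Suc.IH show ?case by (simp add: diff_divide_distrib)
qed

text \<open>The \<open>- r\<close> in each of the \<open>card A\<close> summands becomes the linear
  error, and \<open>1 / (1 + 1 / r) = r / (r + 1)\<close> gives the constant of the main
  term.\<close>

lemma sum_total_degree_ge_powr:
  assumes "finite J" "card J = r + 1" "Poly_Mapping.keys \<gamma> \<subseteq> J" "r > 0"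
    and "total_degree \<gamma> \<le> m" "m > 0"
    and "finite A" "\<And>\<alpha>. \<alpha> \<in> A \<Longrightarrow>
      Poly_Mapping.keys \<alpha> \<subseteq> J \<and> (\<exists>i. Poly_Mapping.lookup \<alpha> i < Poly_Mapping.lookup \<gamma> i)"
  shows "(fact r / real m) powr (1 / real r) * (real r / real (r + 1)) * real (card A) powr (1 + 1 / real r)
    - real r * real (card A) \<le> real (\<Sum>\<alpha>\<in>A. total_degree \<alpha>)"
proof -
  let ?c = "(fact r / real m) powr (1 / real r)"
  have "?c * (real r / real (r + 1)) * real (card A) powr (1 + 1 / real r)
      = ?c * (real (card A) powr (1 + 1 / real r) / (1 + 1 / real r))"
    using assms(4) by (simp add: field_simps)
  also have "\<dots> \<le> ?c * (\<Sum>t=1..card A. real t powr (1 / real r))"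
    using assms(4) by (intro mult_left_mono sum_powr_ge) auto
  also have "\<dots> = (\<Sum>t=1..card A. (fact r / real m * real t) powr (1 / real r) - real r) + real r * real (card A)"
    by (simp only: sum_subtractf sum_distrib_left powr_mult) simp
  also have "\<dots> \<le> real (\<Sum>\<alpha>\<in>A. total_degree \<alpha>) + real r * real (card A)"
    using sum_total_degree_ge[OF assms] by simp
  finally show ?thesis by simp
qed

subsection \<open>Determinants\<close>

lemma det_mat_permutes:
  fixes A :: "nat \<Rightarrow> nat \<Rightarrow> 'a::comm_ring_1"
  shows "det (mat s s (\<lambda>(j, l). A j l)) =
    (\<Sum>\<sigma>\<in>{\<sigma>. \<sigma> permutes {0..<s}}. signof \<sigma> * (\<Prod>j=0..<s. A j (\<sigma> j)))"
  by (subst det_def'[of _ s]) (auto intro!: sum.cong prod.cong simp: permutes_in_image[of _ "{0..<s}"])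

text \<open>Multilinearity in the rows: multiplying out the Leibniz formula picks one generator
  \<open>f j\<close> for each row \<open>j\<close>.\<close>

lemma det_mat_expand:
  fixes V :: "'b \<Rightarrow> nat \<Rightarrow> 'a::comm_ring_1"
  assumes "finite B"
  shows "det (mat s s (\<lambda>(j, l). \<Sum>b\<in>B. C j b * V b l)) =
    (\<Sum>f\<in>{0..<s} \<rightarrow>\<^sub>E B. (\<Prod>j=0..<s. C j (f j)) * det (mat s s (\<lambda>(j, l). V (f j) l)))"
proof -
  let ?P = "{\<sigma>. \<sigma> permutes {0..<s}}"
  let ?E = "{0..<s} \<rightarrow>\<^sub>E B"
  have "det (mat s s (\<lambda>(j, l). \<Sum>b\<in>B. C j b * V b l)) =
      (\<Sum>\<sigma>\<in>?P. signof \<sigma> * (\<Prod>j=0..<s. \<Sum>b\<in>B. C j b * V b (\<sigma> j)))"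
    by (rule det_mat_permutes)
  also have "\<dots> = (\<Sum>\<sigma>\<in>?P. \<Sum>f\<in>?E. signof \<sigma> * (\<Prod>j=0..<s. C j (f j) * V (f j) (\<sigma> j)))"
    using assms by (simp add: prod_sum_PiE sum_distrib_left)
  also have "\<dots> = (\<Sum>f\<in>?E. \<Sum>\<sigma>\<in>?P. signof \<sigma> * (\<Prod>j=0..<s. C j (f j) * V (f j) (\<sigma> j)))"
    by (rule sum.swap)
  also have "\<dots> = (\<Sum>f\<in>?E. (\<Prod>j=0..<s. C j (f j)) * det (mat s s (\<lambda>(j, l). V (f j) l)))"
    by (simp add: det_mat_permutes sum_distrib_left prod.distrib mult.left_commute)
  finally show ?thesis .
qed

lemma det_mat_cong_mod:
  fixes A B :: "nat \<Rightarrow> nat \<Rightarrow> int"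
  assumes "\<And>j l. j < s \<Longrightarrow> l < s \<Longrightarrow> [A j l = B j l] (mod q)"
  shows "[det (mat s s (\<lambda>(j, l). A j l)) = det (mat s s (\<lambda>(j, l). B j l))] (mod q)"
  unfolding det_mat_permutes
  by (intro cong_sum cong_mult cong_refl cong_prod assms) (auto simp: permutes_in_image[of _ "{0..<s}"])

text \<open>In the expansion a choice \<open>f\<close> either repeats a row, and the determinant is
  0, or selects \<open>s\<close> distinct generators, and each Leibniz term is divisible by
  \<open>q\<close> to the sum of their exponents \<open>e\<close>.\<close>

lemma pow_dvd_det_mat:
  fixes q :: int and A :: "nat \<Rightarrow> nat \<Rightarrow> int"
  assumes "finite B"
    and A: "\<And>j l. j < s \<Longrightarrow> l < s \<Longrightarrow> [A j l = (\<Sum>b\<in>B. C j b * V b l)] (mod q ^ N)"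
    and V: "\<And>b l. b \<in> B \<Longrightarrow> l < s \<Longrightarrow> q ^ e b dvd V b l"
    and N: "\<And>B'. B' \<subseteq> B \<Longrightarrow> card B' = s \<Longrightarrow> N \<le> sum e B'"
  shows "q ^ N dvd det (mat s s (\<lambda>(j, l). A j l))"
proof -
  have minor: "q ^ N dvd det (mat s s (\<lambda>(j, l). V (f j) l))" if f: "f \<in> {0..<s} \<rightarrow>\<^sub>E B" for f
  proof (cases "inj_on f {0..<s}")
    case True
    have "N \<le> sum e (f ` {0..<s})"
      using f by (intro N) (auto simp: card_image[OF True])
    also have "\<dots> = (\<Sum>j=0..<s. e (f j))"
      using True by (simp add: sum.reindex)
    finally have "q ^ N dvd (\<Prod>j=0..<s. q ^ e (f j))"
      by (simp add: le_imp_power_dvd flip: power_sum)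
    moreover have "(\<Prod>j=0..<s. q ^ e (f j)) dvd (\<Prod>j=0..<s. V (f j) (\<sigma> j))" if "\<sigma> permutes {0..<s}" for \<sigma>
      using f permutes_in_image[OF that] by (intro prod_dvd_prod V) (auto simp: Pi_iff)
    ultimately show ?thesis
      unfolding det_mat_permutes by (auto intro!: dvd_sum dvd_mult intro: dvd_trans)
  next
    case False
    then obtain i j where ij: "i < s" "j < s" "i \<noteq> j" "f i = f j" by (auto simp: inj_on_def)
    have "det (mat s s (\<lambda>(j, l). V (f j) l)) = 0"
      by (rule det_identical_rows[of _ s i j]) (use ij in \<open>auto intro!: eq_vecI\<close>)
    then show ?thesis by simp
  qed
  have "q ^ N dvd det (mat s s (\<lambda>(j, l). \<Sum>b\<in>B. C j b * V b l))"
    unfolding det_mat_expand[OF assms(1)] by (intro dvd_sum dvd_mult minor)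
  then show ?thesis
    using det_mat_cong_mod[of s A "\<lambda>j l. \<Sum>b\<in>B. C j b * V b l" "q ^ N"] A by (simp add: cong_dvd_iff)
qed

subsection \<open>Reduction to standard monomials\<close>

text \<open>The submodule of vectors of length \<open>s\<close> over the integers modulo
  \<open>Q\<close> generated by the \<open>V b\<close>, kept as integer functions; entries from
  index \<open>s\<close> on are unconstrained.\<close>

definition cong_span :: "int \<Rightarrow> 'b set \<Rightarrow> ('b \<Rightarrow> nat \<Rightarrow> int) \<Rightarrow> nat \<Rightarrow> (nat \<Rightarrow> int) set" where
  "cong_span Q B V s = {v. \<exists>c. \<forall>l<s. [v l = (\<Sum>b\<in>B. c b * V b l)] (mod Q)}"

lemma cong_span_add:
  assumes "u \<in> cong_span Q B V s" "v \<in> cong_span Q B V s"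
  shows "(\<lambda>l. u l + v l) \<in> cong_span Q B V s"
proof -
  obtain c d where "\<forall>l<s. [u l = (\<Sum>b\<in>B. c b * V b l)] (mod Q)" "\<forall>l<s. [v l = (\<Sum>b\<in>B. d b * V b l)] (mod Q)"
    using assms by (auto simp: cong_span_def)
  then show ?thesis
    unfolding cong_span_def
    by (intro CollectI exI[of _ "\<lambda>b. c b + d b"]) (simp add: distrib_right sum.distrib cong_add)
qed

lemma cong_span_scale:
  assumes "v \<in> cong_span Q B V s"
  shows "(\<lambda>l. a * v l) \<in> cong_span Q B V s"
proof -
  obtain c where "\<forall>l<s. [v l = (\<Sum>b\<in>B. c b * V b l)] (mod Q)"
    using assms by (auto simp: cong_span_def)
  then have "\<forall>l<s. [a * v l = a * (\<Sum>b\<in>B. c b * V b l)] (mod Q)"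
    by (auto intro: cong_scalar_left)
  then show ?thesis
    unfolding cong_span_def
    by (intro CollectI exI[of _ "\<lambda>b. a * c b"]) (simp add: sum_distrib_left mult.assoc)
qed

lemma cong_span_cong:
  assumes "v \<in> cong_span Q B V s" "\<And>l. l < s \<Longrightarrow> [u l = v l] (mod Q)"
  shows "u \<in> cong_span Q B V s"
  using assms by (auto simp: cong_span_def intro: cong_trans)

lemma cong_span_0: "(\<lambda>l. 0) \<in> cong_span Q B V s"
  unfolding cong_span_def by (intro CollectI exI[of _ "\<lambda>b. 0"]) simp

lemma cong_span_sum:
  assumes "\<And>k. k \<in> K \<Longrightarrow> f k \<in> cong_span Q B V s"
  shows "(\<lambda>l. \<Sum>k\<in>K. f k l) \<in> cong_span Q B V s"
  using assms
  by (induction K rule: infinite_finite_induct) (auto intro: cong_span_0 cong_span_add)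

lemma cong_span_base:
  assumes "finite B" "b \<in> B"
  shows "V b \<in> cong_span Q B V s"
  unfolding cong_span_def using assms
  by (intro CollectI exI[of _ "\<lambda>b'. if b' = b then 1 else 0"]) (simp add: if_distrib[of "\<lambda>x. x * _"] cong: if_cong)

lemma power_total_degree_dvd_eval_monomial:
  assumes "Poly_Mapping.keys \<alpha> \<subseteq> J" "\<And>i. i \<in> J \<Longrightarrow> q dvd x i"
  shows "q ^ total_degree \<alpha> dvd eval_monomial x \<alpha>"
  unfolding eval_monomial_def weighted_degree_def power_sum
  using assms by (intro prod_dvd_prod) (auto intro: dvd_power_same)

lemma finite_monomials_total_degree:
  assumes "finite J"
  shows "finite {\<alpha>. Poly_Mapping.keys \<alpha> \<subseteq> J \<and> total_degree \<alpha> = n}"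
  by (rule finite_subset[OF _ conjunct1[OF card_monomials_upto[OF assms, of n]]])
    (auto simp: monomials_upto_def)

text \<open>Modulo \<open>q\<close> the monomial \<open>\<gamma>\<close> is the leading monomial of \<open>\<Phi>\<close> for an order refining the
  reversed total degree, so dividing by \<open>\<Phi>\<close> reduces every monomial to those not divisible by \<open>\<gamma>\<close>.
  Each division step either multiplies by \<open>q\<close>, possibly lowering the degree by up to
  \<open>total_degree \<gamma>\<close>, or raises the degree, or keeps the degree and decreases the monomial
  lexicographically.  Hence \<open>e * (total_degree \<gamma> + 1) + total_degree \<alpha>\<close> controls termination.\<close>

lemma monomial_in_standard_span:
  fixes q :: int and z :: "nat \<Rightarrow> nat \<Rightarrow> int"
  assumes J: "finite J" and q: "prime q"
    and \<Phi>: "\<Phi> \<in> mpolys_in J"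
    and lead: "\<not> q dvd Poly_Mapping.lookup \<Phi> \<gamma>"
    and low: "\<And>\<beta>. total_degree \<beta> < total_degree \<gamma> \<Longrightarrow> q dvd Poly_Mapping.lookup \<Phi> \<beta>"
    and lex: "\<And>\<beta>. total_degree \<beta> = total_degree \<gamma> \<Longrightarrow> \<gamma> < \<beta> \<Longrightarrow> q dvd Poly_Mapping.lookup \<Phi> \<beta>"
    and z: "\<And>l i. l < s \<Longrightarrow> i \<in> J \<Longrightarrow> q dvd z l i"
    and root: "\<And>l. l < s \<Longrightarrow> q ^ N dvd eval_mpoly (z l) \<Phi>"
    and B: "B = {\<beta>. Poly_Mapping.keys \<beta> \<subseteq> J \<and> total_degree \<beta> < N \<and>
              (\<exists>i. Poly_Mapping.lookup \<beta> i < Poly_Mapping.lookup \<gamma> i)}"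
    and \<alpha>: "Poly_Mapping.keys \<alpha> \<subseteq> J"
  shows "(\<lambda>l. q ^ e * eval_monomial (z l) \<alpha>) \<in> cong_span (q ^ N) B (\<lambda>\<beta> l. eval_monomial (z l) \<beta>) s"
proof -
  let ?m = "total_degree \<gamma>"
  let ?mon = "\<lambda>e \<alpha> l. q ^ e * eval_monomial (z l) \<alpha>"
  let ?V = "cong_span (q ^ N) B (\<lambda>\<beta> l. eval_monomial (z l) \<beta>) s"
  have finB: "finite B"
    by (rule finite_subset[OF _ conjunct1[OF card_monomials_upto[OF J, of N]]])
      (auto simp: B monomials_upto_def)
  \<comment> \<open>All coordinates \<open>z l i\<close> are divisible by \<open>q\<close>, so such
    a vector is 0 modulo \<open>q ^ N\<close>.\<close>
  have vanish: "?mon e \<alpha> \<in> ?V" if "Poly_Mapping.keys \<alpha> \<subseteq> J" "N \<le> e + total_degree \<alpha>" for e \<alpha>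
  proof (rule cong_span_cong[OF cong_span_0])
    fix l assume l: "l < s"
    have "q ^ e * q ^ total_degree \<alpha> dvd ?mon e \<alpha> l"
      using that(1) z[OF l] by (intro mult_dvd_mono dvd_refl power_total_degree_dvd_eval_monomial)
    moreover have "q ^ N dvd q ^ e * q ^ total_degree \<alpha>"
      using that(2) by (simp add: le_imp_power_dvd flip: power_add)
    ultimately show "[?mon e \<alpha> l = 0] (mod q ^ N)"
      by (simp add: cong_0_iff dvd_trans)
  qed
  \<comment> \<open>The leading coefficient is a unit modulo \<open>q ^ N\<close>.\<close>
  obtain v where v: "[Poly_Mapping.lookup \<Phi> \<gamma> * v = 1] (mod q ^ N)"
  proof -
    have "coprime q (Poly_Mapping.lookup \<Phi> \<gamma>)"
      using prime_imp_coprime[OF q lead] .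
    then have "coprime (Poly_Mapping.lookup \<Phi> \<gamma>) (q ^ N)"
      by (simp add: coprime_commute)
    then show ?thesis using cong_solve_coprime_int that by blast
  qed
  \<comment> \<open>\<open>n\<close> bounds the distance to the threshold
    \<open>N * (?m + 1) + N\<close>, which cannot be reached while both \<open>e\<close> and the
    degree are below \<open>N\<close>.\<close>
  have "?mon e \<alpha> \<in> ?V" if "Poly_Mapping.keys \<alpha> \<subseteq> J" "N * (?m + 1) + N \<le> e * (?m + 1) + total_degree \<alpha> + n" for n e \<alpha>
    using that
  proof (induction n arbitrary: e \<alpha>)
    case 0
    have "N \<le> e \<or> N \<le> total_degree \<alpha>"
    proof (rule ccontr)
      assume "\<not> ?thesis"
      moreover from this have "e * (?m + 1) \<le> N * (?m + 1)" by (intro mult_le_mono1) simp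
      ultimately show False using 0(2) by linarith
    qed
    then show ?case using 0(1) by (intro vanish) auto
  next
    case (Suc n)
    let ?T = "{\<delta>. Poly_Mapping.keys \<delta> \<subseteq> J \<and> total_degree \<delta> = total_degree \<alpha>}"
    have finT: "finite ?T" by (rule finite_monomials_total_degree[OF J])
    \<comment> \<open>An inner induction over the finitely many monomials of the same degree takes
      care of the division steps that leave \<open>n\<close> unchanged.\<close>
    have "?mon e \<delta> \<in> ?V" if "\<delta> \<in> ?T" for \<delta>
      using that
    proof (induction "card {\<delta>' \<in> ?T. \<delta>' < \<delta>}" arbitrary: \<delta> rule: less_induct)
      case less
      note \<delta> = \<open>\<delta> \<in> ?T\<close>
      have smaller: "?mon e \<delta>' \<in> ?V" if "\<delta>' \<in> ?T" "\<delta>' < \<delta>" for \<delta>'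
      proof (rule less.hyps[OF psubset_card_mono that(1)])
        show "finite {\<delta>'' \<in> ?T. \<delta>'' < \<delta>}" by (rule finite_subset[OF _ finT]) auto
        have "\<delta>' \<in> {\<delta>'' \<in> ?T. \<delta>'' < \<delta>} - {\<delta>'' \<in> ?T. \<delta>'' < \<delta>'}" using that by auto
        moreover have "{\<delta>'' \<in> ?T. \<delta>'' < \<delta>'} \<subseteq> {\<delta>'' \<in> ?T. \<delta>'' < \<delta>}"
          using that(2) by (auto intro: less_trans)
        ultimately show "{\<delta>'' \<in> ?T. \<delta>'' < \<delta>'} \<subset> {\<delta>'' \<in> ?T. \<delta>'' < \<delta>}" by blast
      qed
      show ?case
      proof (cases "\<exists>i. Poly_Mapping.lookup \<delta> i < Poly_Mapping.lookup \<gamma> i")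
        case True
        show ?thesis
        \<comment> \<open>Standard monomials of degree at least \<open>N\<close> are missing from
          \<open>B\<close>, but vanish modulo \<open>q ^ N\<close>.\<close>
        proof (cases "total_degree \<delta> < N")
          case True
          then have "\<delta> \<in> B" using \<delta> \<open>\<exists>i. _ i < _ i\<close> by (auto simp: B)
          then show ?thesis
            using cong_span_scale[OF cong_span_base[OF finB, of \<delta> "\<lambda>\<beta> l. eval_monomial (z l) \<beta>"]] by blast
        next
          case False
          then show ?thesis using \<delta> by (intro vanish) auto
        qed
      next
        case False
        define \<epsilon> where "\<epsilon> = \<delta> - \<gamma>"
        have split: "\<delta> = \<gamma> + \<epsilon>"
          using False by (intro poly_mapping_eqI) (simp add: \<epsilon>_def lookup_add lookup_minus not_less)
        have keys\<epsilon>: "Poly_Mapping.keys \<epsilon> \<subseteq> J"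
          using \<delta> by (auto simp: \<epsilon>_def in_keys_iff lookup_minus)
        let ?K = "Poly_Mapping.keys \<Phi> - {\<gamma>}"
        let ?g = "Poly_Mapping.lookup \<Phi>"
        have "(\<lambda>l. \<Sum>\<beta>\<in>?K. - v * ?g \<beta> * ?mon e (\<beta> + \<epsilon>) l) \<in> ?V"
        proof (rule cong_span_sum)
          fix \<beta> assume \<beta>: "\<beta> \<in> ?K"
          have keys: "Poly_Mapping.keys (\<beta> + \<epsilon>) \<subseteq> J"
            using Poly_Mapping.keys_add[of \<beta> \<epsilon>] keys\<epsilon> \<beta> \<Phi> unfolding mpolys_in_def by blast
          have deg: "total_degree (\<beta> + \<epsilon>) + ?m = total_degree \<alpha> + total_degree \<beta>"
            using \<delta> by (simp add: split weighted_degree_add)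
          show "(\<lambda>l. - v * ?g \<beta> * ?mon e (\<beta> + \<epsilon>) l) \<in> ?V"
          proof (cases "q dvd ?g \<beta>")
            case True
            then obtain g' where g': "?g \<beta> = q * g'" ..
            \<comment> \<open>Raising \<open>e\<close> gains \<open>?m + 1\<close>, while the degree
              drops by at most \<open>?m\<close>.\<close>
            have "?mon (e + 1) (\<beta> + \<epsilon>) \<in> ?V"
              using deg Suc.prems(2) by (intro Suc.IH keys) simp
            from cong_span_scale[OF this, of "- v * g'"] show ?thesis
              by (simp add: g' mult_ac)
          next
            case False
            then have "?m \<le> total_degree \<beta>" using low[of \<beta>] by (rule contrapos_np) simp
            have "?mon e (\<beta> + \<epsilon>) \<in> ?V"
            \<comment> \<open>In equal degree the choice of \<open>\<gamma>\<close> forces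
              \<open>\<beta> < \<gamma>\<close>, and the order is compatible with addition; in
              higher degree the outer induction applies.\<close>
            proof (cases "total_degree \<beta> = ?m")
              case True
              then have "\<beta> < \<gamma>"
                using False lex[of \<beta>] \<beta> by (auto simp: neq_iff)
              then have "\<beta> + \<epsilon> < \<delta>"
                unfolding split by (rule add_strict_right_mono)
              then show ?thesis using keys deg True by (intro smaller) auto
            next
              case False
              then show ?thesis
                using deg Suc.prems(2) \<open>?m \<le> total_degree \<beta>\<close> by (intro Suc.IH keys) simp
            qed
            then show ?thesis by (rule cong_span_scale)
          qed
        qed
        then show ?thesis
        proof (rule cong_span_cong)
          fix l assume l: "l < s"
          have "\<gamma> \<in> Poly_Mapping.keys \<Phi>" using lead by (auto simp: in_keys_iff)
          then have "eval_mpoly (z l) \<Phi> = ?g \<gamma> * eval_monomial (z l) \<gamma> + (\<Sum>\<beta>\<in>?K. ?g \<beta> * eval_monomial (z l) \<beta>)"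
            unfolding eval_mpoly_def by (subst sum.remove[of _ \<gamma>]) auto
          \<comment> \<open>The equation \<open>\<Phi> = 0\<close> modulo \<open>q ^ N\<close>,
            multiplied by \<open>v * q ^ e\<close> and the monomial \<open>\<epsilon>\<close>, is
            solved for its leading term.\<close>
          then have "?g \<gamma> * v * ?mon e \<delta> l - (\<Sum>\<beta>\<in>?K. - v * ?g \<beta> * ?mon e (\<beta> + \<epsilon>) l) =
              v * q ^ e * eval_monomial (z l) \<epsilon> * eval_mpoly (z l) \<Phi>"
            by (simp add: split eval_monomial_add sum_distrib_left sum_negf algebra_simps)
          then have c1: "[?g \<gamma> * v * ?mon e \<delta> l = (\<Sum>\<beta>\<in>?K. - v * ?g \<beta> * ?mon e (\<beta> + \<epsilon>) l)] (mod q ^ N)"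
            using root[OF l] by (simp add: cong_iff_dvd_diff)
          have c2: "[?g \<gamma> * v * ?mon e \<delta> l = ?mon e \<delta> l] (mod q ^ N)"
            using cong_scalar_right[OF v, of "?mon e \<delta> l"] by simp
          show "[?mon e \<delta> l = (\<Sum>\<beta>\<in>?K. - v * ?g \<beta> * ?mon e (\<beta> + \<epsilon>) l)] (mod q ^ N)"
            by (rule cong_trans[OF cong_sym[OF c2] c1])
        qed
      qed
    qed
    then show ?case using Suc.prems(1) by auto
  qed
  from this[where n = "N * (?m + 1) + N", OF \<alpha>] show ?thesis by simp
qed

section \<open>The determinant in affine coordinates\<close>

text \<open>\<open>\<beta>\<^sub>0\<close> only certifies that the lowest degree of
  \<open>\<Phi>\<close> modulo \<open>q\<close> is at most \<open>m\<close>. Every row lies modulo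
  \<open>q ^ N\<close> in the span of standard monomials, whose degrees serve as the exponents of
  \<open>q\<close>.\<close>

lemma pow_dvd_det_eval_mpoly:
  fixes q :: int and z :: "nat \<Rightarrow> nat \<Rightarrow> int"
  assumes J: "finite J" "card J = r + 1" "r > 0" and q: "prime q"
    and \<Phi>: "\<Phi> \<in> mpolys_in J"
    and lead: "\<not> q dvd Poly_Mapping.lookup \<Phi> \<beta>\<^sub>0" "total_degree \<beta>\<^sub>0 \<le> m" "m > 0"
    and z: "\<And>l i. l < s \<Longrightarrow> i \<in> J \<Longrightarrow> q dvd z l i"
    and N: "N = nat \<lceil>(fact r / real m) powr (1 / real r) * (real r / real (r + 1)) * real s powr (1 + 1 / real r)
      - real r * real s\<rceil>"
    and root: "\<And>l. l < s \<Longrightarrow> q ^ N dvd eval_mpoly (z l) \<Phi>"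
    and H: "\<And>j. j < s \<Longrightarrow> H j \<in> mpolys_in J"
  shows "q ^ N dvd det (mat s s (\<lambda>(j, l). eval_mpoly (z l) (H j)))"
proof -
  define k where "k = (LEAST k. \<exists>\<beta>. total_degree \<beta> = k \<and> \<not> q dvd Poly_Mapping.lookup \<Phi> \<beta>)"
  have k: "\<exists>\<beta>. total_degree \<beta> = k \<and> \<not> q dvd Poly_Mapping.lookup \<Phi> \<beta>"
    unfolding k_def by (rule LeastI[of _ "total_degree \<beta>\<^sub>0"]) (use lead in auto)
  have k_le: "k \<le> total_degree \<beta>" if "\<not> q dvd Poly_Mapping.lookup \<Phi> \<beta>" for \<beta>
    unfolding k_def by (rule Least_le) (use that in auto)
  define L where "L = {\<beta> \<in> Poly_Mapping.keys \<Phi>. total_degree \<beta> = k \<and> \<not> q dvd Poly_Mapping.lookup \<Phi> \<beta>}"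
  have L: "finite L" "L \<noteq> {}" using k by (auto simp: L_def in_keys_iff)
  \<comment> \<open>Being largest among the monomials of lowest degree modulo \<open>q\<close> is
    what makes \<open>\<gamma>\<close> a leading monomial for the division.\<close>
  define \<gamma> where "\<gamma> = Max L"
  have "\<gamma> \<in> L" unfolding \<gamma>_def by (rule Max_in[OF L])
  then have \<gamma>: "\<gamma> \<in> Poly_Mapping.keys \<Phi>" "total_degree \<gamma> = k" "\<not> q dvd Poly_Mapping.lookup \<Phi> \<gamma>"
    by (auto simp: L_def)
  have low: "q dvd Poly_Mapping.lookup \<Phi> \<beta>" if "total_degree \<beta> < total_degree \<gamma>" for \<beta>
    using k_le[of \<beta>] that \<gamma>(2) by (meson not_le)
  have lex: "q dvd Poly_Mapping.lookup \<Phi> \<beta>" if "total_degree \<beta> = total_degree \<gamma>" "\<gamma> < \<beta>" for \<beta>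
  proof (rule ccontr)
    assume "\<not> ?thesis"
    then have "\<beta> \<in> L" using that(1) \<gamma>(2) by (auto simp: L_def in_keys_iff)
    then have "\<beta> \<le> \<gamma>" unfolding \<gamma>_def by (rule Max_ge[OF L(1)])
    with that(2) show False by simp
  qed
  have keys\<gamma>: "Poly_Mapping.keys \<gamma> \<subseteq> J" using \<gamma>(1) \<Phi> by (auto simp: mpolys_in_def)
  define B where "B = {\<beta>. Poly_Mapping.keys \<beta> \<subseteq> J \<and> total_degree \<beta> < N \<and>
    (\<exists>i. Poly_Mapping.lookup \<beta> i < Poly_Mapping.lookup \<gamma> i)}"
  let ?V = "\<lambda>\<beta> l. eval_monomial (z l) \<beta>"
  have finB: "finite B"
    by (rule finite_subset[OF _ conjunct1[OF card_monomials_upto[OF J(1), of N]]])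
      (auto simp: B_def monomials_upto_def)
  have "(\<lambda>l. eval_mpoly (z l) (H j)) \<in> cong_span (q ^ N) B ?V s" if "j < s" for j
    unfolding eval_mpoly_def
  proof (intro cong_span_sum cong_span_scale)
    fix \<alpha> assume "\<alpha> \<in> Poly_Mapping.keys (H j)"
    then have "Poly_Mapping.keys \<alpha> \<subseteq> J" using H[OF that] by (auto simp: mpolys_in_def)
    from monomial_in_standard_span[OF J(1) q \<Phi> \<gamma>(3) low lex z root B_def this, where e = 0]
    show "(\<lambda>l. eval_monomial (z l) \<alpha>) \<in> cong_span (q ^ N) B ?V s" by simp
  qed
  then have "\<forall>j\<in>{..<s}. \<exists>c. \<forall>l<s. [eval_mpoly (z l) (H j) = (\<Sum>\<beta>\<in>B. c \<beta> * ?V \<beta> l)] (mod q ^ N)"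
    by (auto simp: cong_span_def)
  from bchoice[OF this] obtain C where
    C: "\<And>j l. j < s \<Longrightarrow> l < s \<Longrightarrow> [eval_mpoly (z l) (H j) = (\<Sum>\<beta>\<in>B. C j \<beta> * ?V \<beta> l)] (mod q ^ N)"
    by auto
  show ?thesis
  proof (rule pow_dvd_det_mat[OF finB C, where e = total_degree])
    show "q ^ total_degree \<beta> dvd ?V \<beta> l" if "\<beta> \<in> B" "l < s" for \<beta> l
      using that z by (intro power_total_degree_dvd_eval_monomial[of _ J]) (auto simp: B_def)
    fix B' assume B': "B' \<subseteq> B" "card B' = s"
    have "total_degree \<gamma> \<le> m" using k_le[OF lead(1)] lead(2) \<gamma>(2) by simp
    from sum_total_degree_ge_powr[OF J(1,2) keys\<gamma> J(3) this lead(3), of B']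
    \<comment> \<open>\<open>N\<close> is the real bound rounded up, and a sum of degrees is a
      natural number, so it dominates \<open>N\<close> once it dominates the bound.\<close>
    show "N \<le> sum total_degree B'"
      unfolding N using B' finite_subset[OF B'(1) finB] by (auto simp: B_def nat_le_iff ceiling_le_iff)
  qed
qed

subsection \<open>Points of the weighted hypersurface\<close>

lemma eval_mpoly_of_int_point: "eval_mpoly (\<lambda>i. of_int (x i)) F = of_int (eval_mpoly x F)"
  by (simp add: eval_mpoly_def eval_monomial_def)

lemma eval_monomial_scale:
  "eval_monomial (\<lambda>i. u ^ w i * x i) \<alpha> = u ^ weighted_degree w \<alpha> * eval_monomial x \<alpha>"
  by (simp add: eval_monomial_def weighted_degree_def power_mult_distrib prod.distrib power_sum mult.commute
      flip: power_mult)

lemma eval_mpoly_scale: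
  assumes "\<And>\<alpha>. \<alpha> \<in> Poly_Mapping.keys F \<Longrightarrow> weighted_degree w \<alpha> = d"
  shows "eval_mpoly (\<lambda>i. u ^ w i * x i) F = u ^ d * eval_mpoly x F"
  using assms by (simp add: eval_mpoly_def eval_monomial_scale sum_distrib_left mult.left_commute)

lemma eval_mpoly_cong_mod:
  fixes x y :: "nat \<Rightarrow> int"
  assumes "F \<in> mpolys_in I" "\<And>i. i \<in> I \<Longrightarrow> [x i = y i] (mod q)"
  shows "[eval_mpoly x F = eval_mpoly y F] (mod q)"
  unfolding eval_mpoly_def eval_monomial_def
  using assms by (intro cong_sum cong_mult cong_refl cong_prod cong_pow) (auto simp: mpolys_in_def)

section \<open>Dehomogenisation in a chart of weight 1\<close>

lemma dehomogenise_eq: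
  "dehomogenise i F = (\<Sum>\<alpha>\<in>Poly_Mapping.keys F.
     Poly_Mapping.single (\<alpha> - Poly_Mapping.single i (Poly_Mapping.lookup \<alpha> i)) (Poly_Mapping.lookup F \<alpha>))"
proof -
  have "of_int c * eval_monomial (\<lambda>j. if j = i then 1 else Var j) \<alpha> =
      Poly_Mapping.single (\<alpha> - Poly_Mapping.single i (Poly_Mapping.lookup \<alpha> i)) c" for c :: int and \<alpha>
  proof -
    let ?\<alpha>' = "\<alpha> - Poly_Mapping.single i (Poly_Mapping.lookup \<alpha> i)"
    have "eval_monomial (\<lambda>j. if j = i then 1 else Var j) \<alpha> = eval_monomial (\<lambda>j. if j = i then 1 else Var j) ?\<alpha>'"
      using eval_monomial_add[of "\<lambda>j. if j = i then 1 else Var j"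
          "Poly_Mapping.single i (Poly_Mapping.lookup \<alpha> i)" ?\<alpha>']
      by (simp flip: monomial_split)
    also have "\<dots> = eval_monomial Var ?\<alpha>'"
      by (rule eval_monomial_cong) (auto simp: in_keys_iff lookup_minus lookup_single when_def)
    finally show ?thesis
      by (simp add: eval_monomial_Var mult_single del: single_of_int flip: single_of_int)
  qed
  then show ?thesis by (simp add: dehomogenise_def eval_mpoly_def)
qed

text \<open>As \<open>w i = 1\<close> and all monomials have weighted degree \<open>d\<close>, the
  erased exponent of \<open>i\<close> can be recovered from the rest; so no two terms merge.\<close>

lemma lookup_dehomogenise:
  assumes F: "\<And>\<alpha>. \<alpha> \<in> Poly_Mapping.keys F \<Longrightarrow> weighted_degree w \<alpha> = d"
    and "w i = 1" "\<alpha> \<in> Poly_Mapping.keys F"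
  shows "Poly_Mapping.lookup (dehomogenise i F) (\<alpha> - Poly_Mapping.single i (Poly_Mapping.lookup \<alpha> i)) =
    Poly_Mapping.lookup F \<alpha>"
proof -
  let ?r = "\<lambda>\<alpha>. \<alpha> - Poly_Mapping.single i (Poly_Mapping.lookup \<alpha> i)"
  have deg: "d = Poly_Mapping.lookup \<beta> i + weighted_degree w (?r \<beta>)" if "\<beta> \<in> Poly_Mapping.keys F" for \<beta>
    using arg_cong[OF monomial_split[of \<beta> i], of "weighted_degree w"] F[OF that] assms(2)
    by (simp add: weighted_degree_add)
  have inj: "\<beta> = \<alpha>" if "\<beta> \<in> Poly_Mapping.keys F" "?r \<beta> = ?r \<alpha>" for \<beta>
  proof -
    have "Poly_Mapping.lookup \<beta> i = Poly_Mapping.lookup \<alpha> i"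
      using deg[OF that(1)] deg[OF assms(3)] that(2) by simp
    with that(2) show ?thesis
      using monomial_split[of \<beta> i] monomial_split[of \<alpha> i] by argo
  qed
  have "Poly_Mapping.lookup (dehomogenise i F) (?r \<alpha>) =
      (\<Sum>\<beta>\<in>Poly_Mapping.keys F. Poly_Mapping.lookup F \<beta> when ?r \<beta> = ?r \<alpha>)"
    by (simp add: dehomogenise_eq lookup_sum lookup_single)
  also have "\<dots> = (\<Sum>\<beta>\<in>Poly_Mapping.keys F. if \<beta> = \<alpha> then Poly_Mapping.lookup F \<beta> else 0)"
    using inj by (intro sum.cong refl) (auto simp: when_def)
  also have "\<dots> = Poly_Mapping.lookup F \<alpha>"
    using assms(3) by simp
  finally show ?thesis .
qed

section \<open>Linear coefficients and partial derivatives\<close>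

text \<open>Restriction to the \<open>j\<close>-th axis gives a polynomial in one variable, where
  the usual derivative can be used.\<close>

lemma coeff_eval_mpoly_line:
  "coeff (eval_mpoly (\<lambda>k. if k = j then [:0, 1:] else 0) F) 1 = Poly_Mapping.lookup F (Poly_Mapping.single j 1)"
proof -
  let ?y = "\<lambda>k. if k = j then [:0, 1:] else (0 :: int poly)"
  have mon: "coeff (eval_monomial ?y \<alpha>) 1 = (if \<alpha> = Poly_Mapping.single j 1 then 1 else 0)" for \<alpha>
  proof (cases "Poly_Mapping.keys \<alpha> \<subseteq> {j}")
    case True
    then have \<alpha>: "\<alpha> = Poly_Mapping.single j (Poly_Mapping.lookup \<alpha> j)"
      by (intro poly_mapping_eqI) (auto simp: lookup_single when_def in_keys_iff subset_iff)
    have "coeff (eval_monomial ?y \<alpha>) 1 = coeff (monom 1 (Poly_Mapping.lookup \<alpha> j)) 1"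
      by (subst \<alpha>) (simp add: monom_altdef)
    moreover have "\<alpha> = Poly_Mapping.single j 1 \<longleftrightarrow> Poly_Mapping.lookup \<alpha> j = 1"
      using \<alpha> by (metis lookup_single_eq)
    ultimately show ?thesis by simp
  next
    case False
    then obtain i where i: "i \<in> Poly_Mapping.keys \<alpha>" "i \<noteq> j" by auto
    then have "eval_monomial ?y \<alpha> = 0"
      by (auto simp: eval_monomial_def in_keys_iff intro!: prod_zero bexI[of _ i])
    moreover have "\<alpha> \<noteq> Poly_Mapping.single j 1" using i by auto
    ultimately show ?thesis by simp
  qed
  have "coeff (eval_mpoly ?y F) 1 = (\<Sum>\<alpha>\<in>Poly_Mapping.keys F. Poly_Mapping.lookup F \<alpha> * coeff (eval_monomial ?y \<alpha>) 1)"
    by (simp add: eval_mpoly_def coeff_sum of_int_poly)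
  also have "\<dots> = Poly_Mapping.lookup F (Poly_Mapping.single j 1)"
    unfolding mon by (simp add: if_distrib in_keys_iff cong: if_cong)
  finally show ?thesis .
qed

text \<open>The linear Taylor coefficient, computed on the line through \<open>a\<close> in
  direction \<open>j\<close>. It turns non-singularity into a statement about a coefficient of
  degree 1.\<close>

lemma lookup_translate_single:
  "Poly_Mapping.lookup (translate a G) (Poly_Mapping.single j 1) = eval_mpoly a (partial_deriv j G)"
proof -
  let ?y = "\<lambda>k. of_int (a k) + (if k = j then [:0, 1:] else (0 :: int poly))"
  have mon: "coeff (eval_monomial ?y \<alpha>) 1 =
      int (Poly_Mapping.lookup \<alpha> j) * eval_monomial a (\<alpha> - Poly_Mapping.single j 1)" for \<alpha>
  proof -
    define n where "n = Poly_Mapping.lookup \<alpha> j"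
    define \<beta> where "\<beta> = \<alpha> - Poly_Mapping.single j n"
    have \<alpha>: "\<alpha> = Poly_Mapping.single j n + \<beta>"
      unfolding \<beta>_def n_def by (rule monomial_split)
    have "eval_monomial ?y \<beta> = eval_monomial (\<lambda>k. of_int (a k)) \<beta>"
      by (rule eval_monomial_cong) (auto simp: \<beta>_def n_def in_keys_iff lookup_minus lookup_single when_def)
    also have "\<dots> = of_int (eval_monomial a \<beta>)"
      by (simp add: eval_monomial_def)
    finally have "eval_monomial ?y \<alpha> = smult (eval_monomial a \<beta>) ([:a j, 1:] ^ n)"
      by (simp add: \<alpha> eval_monomial_add of_int_poly mult.commute)
    \<comment> \<open>The coefficient of degree 1 is read off as the derivative at 0.\<close>
    then have "coeff (eval_monomial ?y \<alpha>) 1 = eval_monomial a \<beta> * poly (pderiv ([:a j, 1:] ^ n)) 0"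
      by (simp add: poly_0_coeff_0 coeff_pderiv)
    also have "\<dots> = int n * (a j ^ (n - 1) * eval_monomial a \<beta>)"
      by (simp add: pderiv_power pderiv_pCons)
    also have "\<dots> = int n * eval_monomial a (\<alpha> - Poly_Mapping.single j 1)"
    proof (cases "n = 0")
      case False
      then have "\<alpha> - Poly_Mapping.single j 1 = Poly_Mapping.single j (n - 1) + \<beta>"
        unfolding \<alpha> by (intro poly_mapping_eqI) (auto simp: lookup_add lookup_minus lookup_single when_def)
      then show ?thesis by (simp add: eval_monomial_add)
    qed simp
    finally show ?thesis by (simp add: n_def)
  qed
  have "Poly_Mapping.lookup (translate a G) (Poly_Mapping.single j 1) = coeff (eval_mpoly ?y G) 1"
    unfolding coeff_eval_mpoly_line[symmetric] eval_mpoly_translate ..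
  also have "\<dots> = (\<Sum>\<alpha>\<in>Poly_Mapping.keys G. Poly_Mapping.lookup G \<alpha> * coeff (eval_monomial ?y \<alpha>) 1)"
    by (simp add: eval_mpoly_def coeff_sum of_int_poly)
  also have "\<dots> = eval_mpoly a (partial_deriv j G)"
    unfolding mon by (simp add: partial_deriv_def eval_mpoly_sum mult.assoc)
  finally show ?thesis .
qed

section \<open>The primitive form\<close>

lemma lookup_primitive_form:
  "Poly_Mapping.lookup (primitive_form F) \<alpha> =
    Poly_Mapping.lookup F \<alpha> div Gcd (Poly_Mapping.lookup F ` Poly_Mapping.keys F)"
  by (simp add: primitive_form_def Poly_Mapping.map.rep_eq when_def)

lemma primitive_form_scale:
  "F = of_int (Gcd (Poly_Mapping.lookup F ` Poly_Mapping.keys F)) * primitive_form F"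
proof (rule poly_mapping_eqI)
  fix \<alpha>
  have "Gcd (Poly_Mapping.lookup F ` Poly_Mapping.keys F) dvd Poly_Mapping.lookup F \<alpha>"
    by (cases "\<alpha> \<in> Poly_Mapping.keys F") (auto simp: in_keys_iff intro: Gcd_dvd)
  then show "Poly_Mapping.lookup F \<alpha> = Poly_Mapping.lookup
      (of_int (Gcd (Poly_Mapping.lookup F ` Poly_Mapping.keys F)) * primitive_form F) \<alpha>"
    by (simp add: lookup_of_int_mult lookup_primitive_form)
qed

lemma keys_primitive_form: "Poly_Mapping.keys (primitive_form F) \<subseteq> Poly_Mapping.keys F"
  by (auto simp: in_keys_iff lookup_primitive_form)

lemma Gcd_coeffs_nonzero:
  "F \<noteq> 0 \<Longrightarrow> Gcd (Poly_Mapping.lookup F ` Poly_Mapping.keys F) \<noteq> 0" for F :: "int mpoly"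
  by (auto simp: Gcd_0_iff in_keys_iff poly_mapping_eq_iff fun_eq_iff image_subset_iff)

text \<open>Otherwise \<open>q\<close> times the content of \<open>F\<close> would divide all
  coefficients of \<open>F\<close>, hence the content itself.\<close>

lemma primitive_form_not_dvd:
  assumes "F \<noteq> 0" "prime q"
  shows "\<exists>\<alpha>\<in>Poly_Mapping.keys (primitive_form F). \<not> q dvd Poly_Mapping.lookup (primitive_form F) \<alpha>"
proof (rule ccontr)
  assume "\<not> ?thesis"
  then have dvd: "q dvd Poly_Mapping.lookup (primitive_form F) \<alpha>" for \<alpha>
    by (cases "\<alpha> \<in> Poly_Mapping.keys (primitive_form F)") (auto simp: in_keys_iff)
  let ?g = "Gcd (Poly_Mapping.lookup F ` Poly_Mapping.keys F)"
  have "?g * q dvd Poly_Mapping.lookup F \<alpha>" for \<alpha>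
  proof -
    have "Poly_Mapping.lookup F \<alpha> = ?g * Poly_Mapping.lookup (primitive_form F) \<alpha>"
      using arg_cong[OF primitive_form_scale[of F], of "\<lambda>F. Poly_Mapping.lookup F \<alpha>"]
      unfolding lookup_of_int_mult .
    then show ?thesis using mult_dvd_mono[OF dvd_refl dvd, of ?g \<alpha>] by argo
  qed
  then have "?g * q dvd ?g" by (intro Gcd_greatest) auto
  then show False
    using Gcd_coeffs_nonzero[OF assms(1)] assms(2) not_prime_unit[of q] by simp
qed

lemma weighted_form_primitive_form:
  assumes "weighted_form I w d F"
  shows "primitive_form F \<in> mpolys_in I"
    "\<And>\<alpha>. \<alpha> \<in> Poly_Mapping.keys (primitive_form F) \<Longrightarrow> weighted_degree w \<alpha> = d"
  using assms keys_primitive_form[of F] by (auto simp: weighted_form_def mpolys_in_def)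

text \<open>Dehomogenising keeps all coefficients and translation is invertible. This ensures that
  the \<open>LEAST\<close> in \<open>vanishing_order\<close> is attained.\<close>

lemma translate_dehomogenise_not_dvd:
  assumes "weighted_form I w d F" "w i = 1" "prime q"
  shows "\<exists>\<beta>. \<not> q dvd Poly_Mapping.lookup (translate a (dehomogenise i (primitive_form F))) \<beta>"
proof -
  obtain \<alpha> where \<alpha>: "\<alpha> \<in> Poly_Mapping.keys (primitive_form F)" "\<not> q dvd Poly_Mapping.lookup (primitive_form F) \<alpha>"
    using primitive_form_not_dvd[of F q] assms by (auto simp: weighted_form_def)
  have "\<exists>\<beta>. \<not> q dvd Poly_Mapping.lookup (dehomogenise i (primitive_form F)) \<beta>"
    using lookup_dehomogenise[of "primitive_form F" w d i \<alpha>, OF weighted_form_primitive_form(2)[OF assms(1)]]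
      assms(2) \<alpha> by metis
  then show ?thesis
    using dvd_lookup_translate_iff[of q a] by blast
qed

lemma eval_primitive_form_zero:
  assumes F: "weighted_form I w d F" and Q: "Q \<in> hypersurface I w F" "represents I \<xi> Q"
  shows "eval_mpoly \<xi> (primitive_form F) = 0"
proof -
  have "0 = eval_mpoly (\<lambda>i\<in>I. rat_of_int (\<xi> i)) F"
    using Q by (auto simp: hypersurface_def represents_def)
  also have "\<dots> = eval_mpoly (\<lambda>i. rat_of_int (\<xi> i)) F"
    using F by (intro eval_mpoly_cong) (auto simp: weighted_form_def)
  finally have "eval_mpoly \<xi> F = 0" by (simp add: eval_mpoly_of_int_point)
  moreover have "eval_mpoly \<xi> F = Gcd (Poly_Mapping.lookup F ` Poly_Mapping.keys F) * eval_mpoly \<xi> (primitive_form F)"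
    by (subst primitive_form_scale[of F]) (simp add: eval_mpoly_mult)
  ultimately show ?thesis
    using Gcd_coeffs_nonzero[of F] F by (auto simp: weighted_form_def)
qed

section \<open>Representatives of a point over the residue field\<close>

text \<open>Both tuples are scalings of a common representative \<open>x\<close> by units
  \<open>c\<close> and \<open>c'\<close>; the normalisation \<open>a i = 1\<close> in weight 1
  identifies their ratio as \<open>b i\<close>.\<close>

lemma weighted_class_residue_ring:
  assumes p: "prime p" and P: "P \<in> weighted_proj_space (residue_ring (int p)) I w"
    and ab: "a \<in> P" "b \<in> P" and i: "i \<in> I" "w i = 1" "a i = 1"
  shows "\<And>j. j \<in> I \<Longrightarrow> [b j = b i ^ w j * a j] (mod int p)" "\<not> int p dvd b i"
proof -
  interpret residues "int p" "residue_ring (int p)"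
    using prime_gt_1_nat[OF p] by unfold_locales auto
  obtain x where x: "P = weighted_scaling (residue_ring (int p)) I w `` {x}"
    using P by (auto simp: weighted_proj_space_def elim: quotientE)
  have rel: "\<exists>c. \<not> int p dvd c \<and> (\<forall>j\<in>I. [y j = c ^ w j * x j] (mod int p))" if y: "y \<in> P" for y
  proof -
    obtain c where c: "c \<in> carrier (residue_ring (int p)) - {\<zero>\<^bsub>residue_ring (int p)\<^esub>}"
      "\<forall>j\<in>I. y j = (c [^]\<^bsub>residue_ring (int p)\<^esub> w j) \<otimes>\<^bsub>residue_ring (int p)\<^esub> x j"
      using y by (auto simp: x weighted_scaling_def)
    have c_range: "0 < c" "c < int p" using c(1) by (auto simp: res_carrier_eq res_zero_eq)
    then have "c [^]\<^bsub>residue_ring (int p)\<^esub> n = c ^ n mod int p" for n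
      using pow_cong[of c n] by simp
    with c(2) have "\<forall>j\<in>I. [y j = c ^ w j * x j] (mod int p)"
      by (simp add: res_mult_eq cong_def mod_mult_left_eq)
    moreover have "\<not> int p dvd c" using c_range zdvd_not_zless by blast
    ultimately show ?thesis by blast
  qed
  obtain c where c: "\<not> int p dvd c" "\<And>j. j \<in> I \<Longrightarrow> [a j = c ^ w j * x j] (mod int p)"
    using rel[OF ab(1)] by blast
  obtain c' where c': "\<not> int p dvd c'" "\<And>j. j \<in> I \<Longrightarrow> [b j = c' ^ w j * x j] (mod int p)"
    using rel[OF ab(2)] by blast
  have "[1 = c * x i] (mod int p)" using c(2)[OF i(1)] i by simp
  from cong_scalar_left[OF this, of c'] have 1: "[c' = c * (c' * x i)] (mod int p)" by (simp add: mult_ac)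
  have "[b i = c' * x i] (mod int p)" using c'(2)[OF i(1)] i by simp
  from cong_trans[OF 1 cong_sym[OF cong_scalar_left[OF this, of c]]] have bi: "[c' = c * b i] (mod int p)" .
  then show "\<not> int p dvd b i"
    using c'(1) by (metis cong_dvd_iff dvd_mult)
  fix j assume j: "j \<in> I"
  have cop: "coprime (c ^ w j) (int p)"
    using prime_imp_coprime[of "int p" c] p c(1) by (simp add: coprime_commute)
  have "[c ^ w j * b j = c ^ w j * (c' ^ w j * x j)] (mod int p)"
    by (intro cong_scalar_left c'(2) j)
  also have "[c ^ w j * (c' ^ w j * x j) = c ^ w j * ((c * b i) ^ w j * x j)] (mod int p)"
    by (intro cong_scalar_left cong_scalar_right cong_pow bi)
  also have "c ^ w j * ((c * b i) ^ w j * x j) = c ^ w j * (b i ^ w j * (c ^ w j * x j))"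
    by (simp add: power_mult_distrib mult_ac)
  also have "[\<dots> = c ^ w j * (b i ^ w j * a j)] (mod int p)"
    by (intro cong_scalar_left cong_sym[OF c(2)] j)
  finally show "[b j = b i ^ w j * a j] (mod int p)"
    using cop by (simp add: cong_mult_lcancel)
qed

section \<open>Return from the chart to weighted coordinates\<close>

lemma det_mat_scale_cols:
  fixes A :: "nat \<Rightarrow> nat \<Rightarrow> 'a::comm_ring_1"
  shows "det (mat s s (\<lambda>(j, l). c l * A j l)) = (\<Prod>l=0..<s. c l) * det (mat s s (\<lambda>(j, l). A j l))"
proof -
  have "(\<Prod>j=0..<s. c (\<sigma> j)) = (\<Prod>l=0..<s. c l)" if "\<sigma> permutes {0..<s}" for \<sigma>
    using prod.permute[OF that, of c] by (simp add: o_def)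
  then show ?thesis
    unfolding det_mat_permutes by (simp add: sum_distrib_left prod.distrib mult.left_commute)
qed

text \<open>Dividing each tuple by its \<open>i\<close>-th coordinate modulo a power of
  \<open>p\<close> gives affine coordinates near \<open>a\<close>. As all \<open>M j\<close> have
  weighted degree \<open>D\<close>, this only multiplies column \<open>l\<close> by the unit
  \<open>u l ^ D\<close>. Both bounds of the theorem are instances, with different
  \<open>m\<close>.\<close>

lemma pow_dvd_det_eval_monomial:
  fixes I :: "nat set" and \<xi> :: "nat \<Rightarrow> nat \<Rightarrow> int"
  assumes I: "finite I" "card I = r + 2" "r > 0" and p: "prime p"
    and F: "weighted_form I w d F"
    and P: "P \<in> weighted_proj_space (residue_ring (int p)) I w"
    and chart: "affine_chart I w P i a"
    and lead: "\<not> int p dvd Poly_Mapping.lookup (translate a (dehomogenise i (primitive_form F))) \<beta>\<^sub>0"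
      "total_degree \<beta>\<^sub>0 \<le> m" "m > 0"
    and \<xi>: "\<And>l. l < s \<Longrightarrow> \<exists>Q\<in>hypersurface I w F. represents I (\<xi> l) Q"
      "\<And>l. l < s \<Longrightarrow> reduces_to I p (\<xi> l) P"
    and M: "\<And>j. j < s \<Longrightarrow> Poly_Mapping.keys (M j) \<subseteq> I \<and> weighted_degree w (M j) = D"
    and s: "s \<ge> 1"
  shows "\<exists>N::nat. int p ^ N dvd det (mat s s (\<lambda>(j, l). eval_monomial (\<xi> l) (M j))) \<and>
    real N > (fact r / real m) powr (1 / real r) * (real r / real (r + 1)) * real s powr (1 + 1 / real r)
      - (real r + 1) * real s"
proof -
  define N where N: "N = nat \<lceil>(fact r / real m) powr (1 / real r) * (real r / real (r + 1))
    * real s powr (1 + 1 / real r) - real r * real s\<rceil>"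
  let ?q = "int p ^ N"
  let ?G = "primitive_form F"
  let ?J = "I - {i}"
  have i: "i \<in> I" "w i = 1" "a \<in> P" "a i = 1" using chart by (auto simp: affine_chart_def)
  have q: "prime (int p)" using p by simp
  have res: "[\<xi> l j = \<xi> l i ^ w j * a j] (mod int p)" "\<not> int p dvd \<xi> l i" if "l < s" "j \<in> I" for l j
  proof -
    let ?b = "\<lambda>i\<in>I. \<xi> l i mod int p"
    have "?b \<in> P" using \<xi>(2)[OF that(1)] by (simp add: reduces_to_def)
    note b = weighted_class_residue_ring[OF p P i(3) this i(1,2,4)]
    have "[?b j = ?b i ^ w j * a j] (mod int p)" by (rule b(1)[OF that(2)])
    moreover have "[?b j = \<xi> l j] (mod int p)" "[?b i = \<xi> l i] (mod int p)"
      using that(2) i(1) by (auto simp: cong_def)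
    ultimately show "[\<xi> l j = \<xi> l i ^ w j * a j] (mod int p)"
      by (meson cong_pow cong_scalar_right cong_sym cong_trans)
    show "\<not> int p dvd \<xi> l i"
      using b(2) i(1) by (simp add: dvd_mod_iff)
  qed
  \<comment> \<open>The exponent \<open>Suc N\<close> makes \<open>u\<close> an inverse modulo
    \<open>p\<close> as well, even if \<open>N = 0\<close>.\<close>
  have "\<exists>u. [\<xi> l i * u = 1] (mod int p ^ Suc N)" if "l < s" for l
  proof (rule cong_solve_coprime_int)
    have "coprime (int p) (\<xi> l i)"
      using prime_imp_coprime[OF q res(2)[OF that i(1)]] .
    then show "coprime (\<xi> l i) (int p ^ Suc N)"
      by (simp only: coprime_power_right_iff coprime_commute) simp
  qed
  then obtain u where u: "\<And>l. l < s \<Longrightarrow> [\<xi> l i * u l = 1] (mod int p ^ Suc N)" by metis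
  have u_p: "[u l * \<xi> l i = 1] (mod int p)" and u_q: "[u l * \<xi> l i = 1] (mod ?q)" if "l < s" for l
    using cong_dvd_modulus[OF u[OF that], of "int p"] cong_dvd_modulus[OF u[OF that], of ?q]
    by (simp_all add: mult.commute[of "u l"])
  \<comment> \<open>\<open>y l\<close> is the rescaled tuple, whose \<open>i\<close>-th coordinate
    is 1 only modulo \<open>p ^ N\<close>; in \<open>z l\<close> it is reset to exactly 1 before
    \<open>a\<close> is subtracted.\<close>
  define y where "y l k = u l ^ w k * \<xi> l k" for l k
  define z where "z l k = ((y l)(i := 1)) k - a k" for l k
  have y: "[y l k = ((y l)(i := 1)) k] (mod ?q)" if "l < s" for l k
    using u_q[OF that] i(2) by (simp add: y_def)
  have z_i: "z l i = 0" for l by (simp add: z_def i(4))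
  have z_dvd: "int p dvd z l k" if "l < s" "k \<in> ?J" for l k
  proof -
    have "[u l ^ w k * \<xi> l k = u l ^ w k * (\<xi> l i ^ w k * a k)] (mod int p)"
      using that by (intro cong_scalar_left res(1)) auto
    also have "u l ^ w k * (\<xi> l i ^ w k * a k) = (u l * \<xi> l i) ^ w k * a k"
      by (simp add: power_mult_distrib)
    also have "[(u l * \<xi> l i) ^ w k * a k = 1 ^ w k * a k] (mod int p)"
      by (intro cong_scalar_right cong_pow u_p that)
    finally show ?thesis using that(2) by (simp add: z_def y_def cong_iff_dvd_diff)
  qed
  have eval: "[eval_mpoly (z l) (translate a (dehomogenise i H)) = u l ^ k * eval_mpoly (\<xi> l) H] (mod ?q)"
    if "l < s" "H \<in> mpolys_in I" "\<And>\<alpha>. \<alpha> \<in> Poly_Mapping.keys H \<Longrightarrow> weighted_degree w \<alpha> = k" for l H k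
  proof -
    have "eval_mpoly (z l) (translate a (dehomogenise i H)) = eval_mpoly ((y l)(i := 1)) H"
      unfolding eval_mpoly_translate_dehomogenise[of a i "z l", OF i(4) z_i]
      by (simp add: z_def flip: fun_upd_def)
    also have "[eval_mpoly ((y l)(i := 1)) H = eval_mpoly (y l) H] (mod ?q)"
      by (rule eval_mpoly_cong_mod[OF that(2)]) (rule cong_sym[OF y[OF that(1)]])
    also have "eval_mpoly (y l) H = u l ^ k * eval_mpoly (\<xi> l) H"
      unfolding y_def by (rule eval_mpoly_scale[OF that(3)])
    finally show ?thesis .
  qed
  define H where "H j = translate a (dehomogenise i (Poly_Mapping.single (M j) 1))" for j
  have mono: "Poly_Mapping.single (M j) 1 \<in> mpolys_in I" if "j < s" for j
    using M[OF that] by (auto simp: mpolys_in_def)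
  have "?q dvd det (mat s s (\<lambda>(j, l). eval_mpoly (z l) (H j)))"
  proof (rule pow_dvd_det_eval_mpoly[OF _ _ I(3) q _ lead z_dvd N])
    show "finite ?J" "card ?J = r + 1" using I i(1) by auto
    show "translate a (dehomogenise i ?G) \<in> mpolys_in ?J"
      by (intro translate_in_mpolys_in dehomogenise_in_mpolys_in weighted_form_primitive_form(1)[OF F])
    show "H j \<in> mpolys_in ?J" if "j < s" for j
      unfolding H_def by (intro translate_in_mpolys_in dehomogenise_in_mpolys_in mono[OF that])
    fix l assume l: "l < s"
    have "eval_mpoly (\<xi> l) ?G = 0"
      using eval_primitive_form_zero[OF F] \<xi>(1)[OF l] by blast
    with eval[OF l weighted_form_primitive_form[OF F]]
    show "?q dvd eval_mpoly (z l) (translate a (dehomogenise i ?G))"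
      by (simp add: cong_0_iff)
  qed
  moreover have "[det (mat s s (\<lambda>(j, l). eval_mpoly (z l) (H j))) =
      det (mat s s (\<lambda>(j, l). u l ^ D * eval_monomial (\<xi> l) (M j)))] (mod ?q)"
  proof (rule det_mat_cong_mod)
    fix j l assume jl: "j < s" "l < s"
    show "[eval_mpoly (z l) (H j) = u l ^ D * eval_monomial (\<xi> l) (M j)] (mod ?q)"
      using eval[OF jl(2) mono[OF jl(1)], of D] M[OF jl(1)] by (simp add: H_def)
  qed
  ultimately have dvd: "?q dvd (\<Prod>l=0..<s. u l ^ D) * det (mat s s (\<lambda>(j, l). eval_monomial (\<xi> l) (M j)))"
    by (simp only: cong_dvd_iff det_mat_scale_cols)
  \<comment> \<open>The \<open>u l\<close> are units modulo \<open>p\<close>, so the column factors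
    cancel.\<close>
  have "coprime ?q (\<Prod>l=0..<s. u l ^ D)"
  proof (rule prod_coprime_right)
    fix l assume "l \<in> {0..<s}"
    then have "\<not> int p dvd u l"
      using u_p[of l] q by (metis atLeastLessThan_iff cong_dvd_iff dvd_mult2 not_prime_unit)
    then show "coprime ?q (u l ^ D)"
      using prime_imp_coprime[OF q] by simp
  qed
  with dvd have "?q dvd det (mat s s (\<lambda>(j, l). eval_monomial (\<xi> l) (M j)))"
    by (simp add: coprime_dvd_mult_right_iff)
  moreover have "(fact r / real m) powr (1 / real r) * (real r / real (r + 1)) * real s powr (1 + 1 / real r)
      - real r * real s \<le> real N"
    unfolding N by (rule real_nat_ceiling_ge)
  \<comment> \<open>Since \<open>s \<ge> 1\<close>, replacing \<open>r\<close> by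
    \<open>r + 1\<close> in the linear term makes the inequality strict.\<close>
  ultimately show ?thesis
    using s by (intro exI[of _ N]) (simp add: algebra_simps)
qed

section \<open>Choice of the constants and the two bounds\<close>

theorem theorem4p1:
  shows "\<exists>(\<kappa> :: nat \<Rightarrow> nat \<Rightarrow> real) (\<kappa>' :: nat \<Rightarrow> real).
    (\<forall>d r. \<kappa> d r > 0) \<and> (\<forall>r. \<kappa>' r > 0) \<and>
    (\<forall>(r::nat) (d::nat) (w :: nat \<Rightarrow> nat) (p::nat) (F :: int mpoly)
      (P :: (nat \<Rightarrow> int) set) (m::nat) (s::nat) (\<xi> :: nat \<Rightarrow> nat \<Rightarrow> int)
      (M :: nat \<Rightarrow> monomial) (D::nat).
      r \<ge> 1 \<longrightarrow>
      w 0 = 1 \<longrightarrow> w 1 = 1 \<longrightarrow> (\<forall>i\<in>{..r+1}. w i \<ge> 1) \<longrightarrow>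
      prime p \<longrightarrow>
      weighted_form {..r+1} w d F \<longrightarrow>
      P \<in> reduced_hypersurface {..r+1} w p F \<longrightarrow>
      has_multiplicity {..r+1} w p F P m \<longrightarrow>
      s \<ge> 1 \<longrightarrow>
      inj_on (\<lambda>l. restrict (\<xi> l) {..r+1}) {..<s} \<longrightarrow>
      (\<forall>l<s. primitive_tuple {..r+1} (\<xi> l) \<and>
             (\<exists>Q\<in>hypersurface {..r+1} w F. represents {..r+1} (\<xi> l) Q) \<and>
             reduces_to {..r+1} p (\<xi> l) P \<and>
             gcd (\<xi> l 0) (\<xi> l 1) = 1) \<longrightarrow>
      (\<forall>j<s. Poly_Mapping.keys (M j) \<subseteq> {..r+1} \<and> weighted_degree w (M j) = D) \<longrightarrow>
      (\<exists>N::nat.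
         int p ^ N dvd det (mat s s (\<lambda>(j, l). eval_monomial (\<xi> l) (M j))) \<and>
         real N > (fact r / real m) powr (1 / real r) * (real r / real (r + 1))
                    * real s powr (1 + 1 / real r) - \<kappa> d r * real s) \<and>
      (nonsingular_point {..r+1} w p F P \<longrightarrow>
        (\<exists>N::nat.
           int p ^ N dvd det (mat s s (\<lambda>(j, l). eval_monomial (\<xi> l) (M j))) \<and>
           real N > (fact r) powr (1 / real r) * (real r / real (r + 1))
                      * real s powr (1 + 1 / real r) - \<kappa>' r * real s)))"
proof (intro exI[of _ "\<lambda>d r. real r + 1"] exI[of _ "\<lambda>r. real r + 1"] conjI allI impI, goal_cases)
  case (3 r d w p F P m s \<xi> M D)
  let ?I = "{..r+1}"
  have I: "finite ?I" "card ?I = r + 2" "r > 0" using 3(1) by auto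
  have P: "P \<in> weighted_proj_space (residue_ring (int p)) ?I w"
    using 3(7) by (auto simp: reduced_hypersurface_def)
  obtain i a where ia: "affine_chart ?I w P i a"
    "m = vanishing_order p a (dehomogenise i (primitive_form F))"
    using 3(8) by (auto simp: has_multiplicity_def)
  show ?case
  proof (cases "m = 0")
    case True
    \<comment> \<open>Division by 0 gives 0, and so does its power; the bound is then negative and
      \<open>N = 0\<close> works.\<close>
    then show ?thesis by (intro exI[of _ 0]) (use 3(9) in simp)
  next
    case False
    let ?T = "translate a (dehomogenise i (primitive_form F))"
    have "w i = 1" "prime (int p)" using ia(1) 3(5) by (simp_all add: affine_chart_def)
    from translate_dehomogenise_not_dvd[OF 3(6) this, of a]
    obtain \<beta> where "\<not> int p dvd Poly_Mapping.lookup ?T \<beta>" by blast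
    \<comment> \<open>The least degree is attained, which yields a witness of degree exactly
      \<open>m\<close>.\<close>
    then have "\<exists>\<beta>. total_degree \<beta> = m \<and> \<not> int p dvd Poly_Mapping.lookup ?T \<beta>"
      unfolding ia(2) vanishing_order_def
      by (rule LeastI[of "\<lambda>k. \<exists>\<beta>. total_degree \<beta> = k \<and> \<not> int p dvd Poly_Mapping.lookup ?T \<beta>", OF exI, OF conjI[OF refl]])
    then obtain \<beta>\<^sub>0 where \<beta>\<^sub>0: "total_degree \<beta>\<^sub>0 = m" "\<not> int p dvd Poly_Mapping.lookup ?T \<beta>\<^sub>0" by blast
    show ?thesis
      using \<beta>\<^sub>0(1) False 3(9,11,12)
      by (intro pow_dvd_det_eval_monomial[OF I 3(5,6) P ia(1) \<beta>\<^sub>0(2)]) auto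
  qed
next
  case (4 r d w p F P m s \<xi> M D)
  let ?I = "{..r+1}"
  have I: "finite ?I" "card ?I = r + 2" "r > 0" using 4(1) by auto
  have P: "P \<in> weighted_proj_space (residue_ring (int p)) ?I w"
    using 4(7) by (auto simp: reduced_hypersurface_def)
  obtain i a j where ia: "affine_chart ?I w P i a"
    "\<not> int p dvd eval_mpoly a (partial_deriv j (dehomogenise i (primitive_form F)))"
    using 4(13) by (auto simp: nonsingular_point_def)
  \<comment> \<open>The non-vanishing derivative is a coefficient of degree 1, so the bound holds
    with 1 in place of \<open>m\<close>, in the chart that non-singularity supplies.\<close>
  have "\<not> int p dvd Poly_Mapping.lookup (translate a (dehomogenise i (primitive_form F))) (Poly_Mapping.single j 1)"
    using ia(2) by (simp only: lookup_translate_single not_False_eq_True)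
  from pow_dvd_det_eval_monomial[OF I 4(5,6) P ia(1) this, of 1] show ?case
    using 4(9,11,12) by simp
qed auto

end
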